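(* Let $(V,m)$ be a discrete measure space and $(b,c)$ a locally finite graph over $(V,m)$. Let $L$ be a non-negative selfadjoint operator on $\ell^2(V,m)$ which is a restriction of $\widetilde L$ and whose associated form $Q$ is a Dirichlet form. Then $$Q^{(N)}\le Q\le Q^{(D)}.$$
   Context: $V$ is a finite or countably infinite set and $m:V\to(0,\infty)$; $(V,m)$ is a discrete measure space. $C(V)$ is the set of all functions $V\to\mathbb C$, $C_c(V)$ the finitely supported ones, and $\ell^2(V,m)$ carries $\langle u,v\rangle=\sum_x u(x)\overline{v(x)}m(x)$. A graph over $(V,m)$ is a pair $(b,c)$ with $c:V\to[0,\infty)$, $b:V\times V\to[0,\infty)$, $b(x,x)=0$, $b(x,y)=b(y,x)$, $\sum_y b(x,y)<\infty$; it is locally finite if $\{y:b(x,y)>0\}$ is finite for every $x$. For $u\in C(V)$ (for locally finite graphs all sums below are finite) define $\widetilde L u(x)=\frac{1}{m(x)}\sum_y b(x,y)(u(x)-u(y))+\frac{c(x)}{m(x)}u(x)$; "$L$ is a restriction of $\widetilde L$" means $Lu=\widetilde Lu$ on the domain of $L$. $Q^{(N)}$ is the form on $\ell^2(V,m)$ with domain $D(Q^{(N)})=\{u\in\ell^2(V,m):\frac12\sum_{x,y}b(x,y)|u(x)-u(y)|^2+\sum_x c(x)|u(x)|^2<\infty\}$ and $Q^{(N)}(u,v)=\frac12\sum_{x,y}b(x,y)(u(x)-u(y))\overline{(v(x)-v(y))}+\sum_x c(x)u(x)\overline{v(x)}$. $Q^{(D)}$ is the closure of the restriction of $Q^{(N)}$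 to $C_c(V)$. The form associated to a non-negative selfadjoint $L$ is $Q(u,v)=\langle L^{1/2}u,L^{1/2}v\rangle$ on $D(Q)=D(L^{1/2})$. A Dirichlet form is a non-negative closed symmetric form $Q$ such that for every $u\in D(Q)$ and every normal contraction $C:\mathbb C\to\mathbb C$ (i.e. $C(0)=0$, $|C(s)-C(t)|\le|s-t|$) one has $C\circ u\in D(Q)$ and $Q(C\circ u,C\circ u)\le Q(u,u)$. For non-negative forms, $Q_1\le Q_2$ means $D(Q_2)\subseteq D(Q_1)$ and $Q_1(u,u)\le Q_2(u,u)$ for all $u\in D(Q_2)$. *)

theory Defs
  imports "HOL-Analysis.Analysis"
begin

type_synonym 'v fn = "'v \<Rightarrow> complex"

definition l2 :: "('v \<Rightarrow> real) \<Rightarrow> 'v fn set" where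
  "l2 m = {u. (\<lambda>x. (cmod (u x))^2 * m x) summable_on UNIV}"

definition l2inner :: "('v \<Rightarrow> real) \<Rightarrow> 'v fn \<Rightarrow> 'v fn \<Rightarrow> complex" where
  "l2inner m u v = infsum (\<lambda>x. u x * cnj (v x) * complex_of_real (m x)) UNIV"

definition l2norm :: "('v \<Rightarrow> real) \<Rightarrow> 'v fn \<Rightarrow> real" where
  "l2norm m u = sqrt (infsum (\<lambda>x. (cmod (u x))^2 * m x) UNIV)"

definition l2_subspace :: "('v \<Rightarrow> real) \<Rightarrow> 'v fn set \<Rightarrow> bool" where
  "l2_subspace m D \<longleftrightarrow> D \<subseteq> l2 m \<and> (\<lambda>x. 0) \<in> D \<and>
     (\<forall>u\<in>D. \<forall>v\<in>D. \<forall>a::complex. (\<lambda>x. u x + a * v x) \<in> D)"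

definition l2_dense :: "('v \<Rightarrow> real) \<Rightarrow> 'v fn set \<Rightarrow> bool" where
  "l2_dense m D \<longleftrightarrow> (\<forall>u\<in>l2 m. \<forall>e>0. \<exists>v\<in>D. l2norm m (\<lambda>x. u x - v x) < e)"

section \<open>Operators (domain D, action L; values of L outside D are irrelevant)\<close>

definition linear_op :: "('v \<Rightarrow> real) \<Rightarrow> 'v fn set \<Rightarrow> ('v fn \<Rightarrow> 'v fn) \<Rightarrow> bool" where
  "linear_op m D L \<longleftrightarrow> l2_subspace m D \<and> (\<forall>u\<in>D. L u \<in> l2 m) \<and>
     (\<forall>u\<in>D. \<forall>v\<in>D. \<forall>a::complex. L (\<lambda>x. u x + a * v x) = (\<lambda>x. L u x + a * L v x))"

definition adjoint_dom :: "('v \<Rightarrow> real) \<Rightarrow> 'v fn set \<Rightarrow> ('v fn \<Rightarrow> 'v fn) \<Rightarrow> 'v fn set" where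
  "adjoint_dom m D L = {v \<in> l2 m. \<exists>w\<in>l2 m. \<forall>u\<in>D. l2inner m (L u) v = l2inner m u w}"

definition selfadjoint :: "('v \<Rightarrow> real) \<Rightarrow> 'v fn set \<Rightarrow> ('v fn \<Rightarrow> 'v fn) \<Rightarrow> bool" where
  "selfadjoint m D L \<longleftrightarrow> linear_op m D L \<and> l2_dense m D \<and> adjoint_dom m D L = D \<and>
     (\<forall>u\<in>D. \<forall>v\<in>D. l2inner m (L u) v = l2inner m u (L v))"

definition nonneg_op :: "('v \<Rightarrow> real) \<Rightarrow> 'v fn set \<Rightarrow> ('v fn \<Rightarrow> 'v fn) \<Rightarrow> bool" where
  "nonneg_op m D L \<longleftrightarrow> (\<forall>u\<in>D. 0 \<le> Re (l2inner m (L u) u))"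

definition op_sqrt :: "('v \<Rightarrow> real) \<Rightarrow> 'v fn set \<Rightarrow> ('v fn \<Rightarrow> 'v fn) \<Rightarrow> 'v fn set \<times> ('v fn \<Rightarrow> 'v fn)" where
  "op_sqrt m D L = (THE (DS, S). selfadjoint m DS S \<and> nonneg_op m DS S \<and>
      (\<forall>u. u \<notin> DS \<longrightarrow> S u = (\<lambda>x. 0)) \<and>
      D = {u \<in> DS. S u \<in> DS} \<and> (\<forall>u\<in>D. S (S u) = L u))"

definition assoc_form_dom :: "('v \<Rightarrow> real) \<Rightarrow> 'v fn set \<Rightarrow> ('v fn \<Rightarrow> 'v fn) \<Rightarrow> 'v fn set" where
  "assoc_form_dom m D L = fst (op_sqrt m D L)"

definition assoc_form :: "('v \<Rightarrow> real) \<Rightarrow> 'v fn set \<Rightarrow> ('v fn \<Rightarrow> 'v fn) \<Rightarrow> 'v fn \<Rightarrow> 'v fn \<Rightarrow> complex" where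
  "assoc_form m D L u v = l2inner m (snd (op_sqrt m D L) u) (snd (op_sqrt m D L) v)"

definition is_form :: "('v \<Rightarrow> real) \<Rightarrow> 'v fn set \<Rightarrow> ('v fn \<Rightarrow> 'v fn \<Rightarrow> complex) \<Rightarrow> bool" where
  "is_form m D q \<longleftrightarrow> l2_subspace m D \<and>
     (\<forall>u\<in>D. \<forall>v\<in>D. \<forall>w\<in>D. \<forall>a::complex.
        q (\<lambda>x. u x + a * v x) w = q u w + a * q v w \<and>
        q w (\<lambda>x. u x + a * v x) = q w u + cnj a * q w v)"

definition nonneg_form :: "'v fn set \<Rightarrow> ('v fn \<Rightarrow> 'v fn \<Rightarrow> complex) \<Rightarrow> bool" where
  "nonneg_form D q \<longleftrightarrow> (\<forall>u\<in>D. Im (q u u) = 0 \<and> 0 \<le> Re (q u u))"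

definition symmetric_form :: "'v fn set \<Rightarrow> ('v fn \<Rightarrow> 'v fn \<Rightarrow> complex) \<Rightarrow> bool" where
  "symmetric_form D q \<longleftrightarrow> (\<forall>u\<in>D. \<forall>v\<in>D. q u v = cnj (q v u))"

definition form_cauchy :: "('v fn \<Rightarrow> 'v fn \<Rightarrow> complex) \<Rightarrow> (nat \<Rightarrow> 'v fn) \<Rightarrow> bool" where
  "form_cauchy q s \<longleftrightarrow> (\<forall>e>0. \<exists>N. \<forall>n\<ge>N. \<forall>k\<ge>N.
      Re (q (\<lambda>x. s n x - s k x) (\<lambda>x. s n x - s k x)) < e)"

text \<open>Closedness: D(Q) complete w.r.t. the form norm (Q(u,u) + ||u||^2)^(1/2).\<close>
definition closed_form :: "('v \<Rightarrow> real) \<Rightarrow> 'v fn set \<Rightarrow> ('v fn \<Rightarrow> 'v fn \<Rightarrow> complex) \<Rightarrow> bool" where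
  "closed_form m D q \<longleftrightarrow> (\<forall>s u. (\<forall>n. s n \<in> D) \<and> u \<in> l2 m \<and>
      (\<lambda>n. l2norm m (\<lambda>x. s n x - u x)) \<longlonglongrightarrow> 0 \<and> form_cauchy q s \<longrightarrow>
      u \<in> D \<and> (\<lambda>n. Re (q (\<lambda>x. s n x - u x) (\<lambda>x. s n x - u x))) \<longlonglongrightarrow> 0)"

definition normal_contraction :: "(complex \<Rightarrow> complex) \<Rightarrow> bool" where
  "normal_contraction C \<longleftrightarrow> C 0 = 0 \<and> (\<forall>s t. cmod (C s - C t) \<le> cmod (s - t))"

definition dirichlet_form :: "('v \<Rightarrow> real) \<Rightarrow> 'v fn set \<Rightarrow> ('v fn \<Rightarrow> 'v fn \<Rightarrow> complex) \<Rightarrow> bool" where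
  "dirichlet_form m D q \<longleftrightarrow> is_form m D q \<and> nonneg_form D q \<and> symmetric_form D q \<and>
     closed_form m D q \<and>
     (\<forall>u\<in>D. \<forall>C. normal_contraction C \<longrightarrow>
        (C \<circ> u) \<in> D \<and> Re (q (C \<circ> u) (C \<circ> u)) \<le> Re (q u u))"

definition form_le :: "'v fn set \<Rightarrow> ('v fn \<Rightarrow> 'v fn \<Rightarrow> complex) \<Rightarrow>
                       'v fn set \<Rightarrow> ('v fn \<Rightarrow> 'v fn \<Rightarrow> complex) \<Rightarrow> bool" where
  "form_le D1 q1 D2 q2 \<longleftrightarrow> D2 \<subseteq> D1 \<and> (\<forall>u\<in>D2. Re (q1 u u) \<le> Re (q2 u u))"

definition graph_over :: "('v \<Rightarrow> 'v \<Rightarrow> real) \<Rightarrow> ('v \<Rightarrow> real) \<Rightarrow> bool" where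
  "graph_over b c \<longleftrightarrow> (\<forall>x. 0 \<le> c x) \<and> (\<forall>x y. 0 \<le> b x y) \<and> (\<forall>x. b x x = 0) \<and>
     (\<forall>x y. b x y = b y x) \<and> (\<forall>x. (\<lambda>y. b x y) summable_on UNIV)"

definition locally_finite :: "('v \<Rightarrow> 'v \<Rightarrow> real) \<Rightarrow> bool" where
  "locally_finite b \<longleftrightarrow> (\<forall>x. finite {y. 0 < b x y})"

text \<open>Formal operator L~ (for locally finite graphs the sum over y is the finite sum over neighbours).\<close>
definition Ltilde :: "('v \<Rightarrow> 'v \<Rightarrow> real) \<Rightarrow> ('v \<Rightarrow> real) \<Rightarrow> ('v \<Rightarrow> real) \<Rightarrow> 'v fn \<Rightarrow> 'v fn" where
  "Ltilde b c m u x = (\<Sum>y\<in>{y. 0 < b x y}. complex_of_real (b x y) * (u x - u y)) / complex_of_real (m x)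
      + complex_of_real (c x / m x) * u x"

definition domN :: "('v \<Rightarrow> real) \<Rightarrow> ('v \<Rightarrow> 'v \<Rightarrow> real) \<Rightarrow> ('v \<Rightarrow> real) \<Rightarrow> 'v fn set" where
  "domN m b c = {u \<in> l2 m. (\<lambda>(x,y). b x y * (cmod (u x - u y))^2) summable_on UNIV \<and>
                           (\<lambda>x. c x * (cmod (u x))^2) summable_on UNIV}"

definition qN :: "('v \<Rightarrow> 'v \<Rightarrow> real) \<Rightarrow> ('v \<Rightarrow> real) \<Rightarrow> 'v fn \<Rightarrow> 'v fn \<Rightarrow> complex" where
  "qN b c u v = (1/2) * infsum (\<lambda>(x,y). complex_of_real (b x y) * (u x - u y) * cnj (v x - v y)) UNIV
      + infsum (\<lambda>x. complex_of_real (c x) * u x * cnj (v x)) UNIV"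

definition Cc :: "'v fn set" where
  "Cc = {u. finite {x. u x \<noteq> 0}}"

text \<open>Q^(D): closure of Q^(N) restricted to C_c(V).\<close>
definition approxD :: "('v \<Rightarrow> real) \<Rightarrow> ('v \<Rightarrow> 'v \<Rightarrow> real) \<Rightarrow> ('v \<Rightarrow> real) \<Rightarrow> (nat \<Rightarrow> 'v fn) \<Rightarrow> 'v fn \<Rightarrow> bool" where
  "approxD m b c s u \<longleftrightarrow> (\<forall>n. s n \<in> Cc) \<and>
     (\<lambda>n. l2norm m (\<lambda>x. s n x - u x)) \<longlonglongrightarrow> 0 \<and> form_cauchy (qN b c) s"

definition domD :: "('v \<Rightarrow> real) \<Rightarrow> ('v \<Rightarrow> 'v \<Rightarrow> real) \<Rightarrow> ('v \<Rightarrow> real) \<Rightarrow> 'v fn set" where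
  "domD m b c = {u \<in> l2 m. \<exists>s. approxD m b c s u}"

definition qD :: "('v \<Rightarrow> real) \<Rightarrow> ('v \<Rightarrow> 'v \<Rightarrow> real) \<Rightarrow> ('v \<Rightarrow> real) \<Rightarrow> 'v fn \<Rightarrow> 'v fn \<Rightarrow> complex" where
  "qD m b c u v = (THE z. \<forall>s t. approxD m b c s u \<and> approxD m b c t v \<longrightarrow>
                              (\<lambda>n. qN b c (s n) (t n)) \<longlonglongrightarrow> z)"

end

(* Local finiteness and self-adjointness put C_c(V) into the domain of L, and there Q agrees with
   Q^(N) by summation by parts; closedness of Q then gives Q <= Q^(D).

   For Q^(N) <= Q, fix a finite set K and t > 0 and consider the coercive form Q_t = <.,.> + t Q.
   Let h_x be the Q_t-harmonic function with boundary values 1_x on K. Since truncation to [0,1]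
   does not increase Q_t, one has 0 <= h_x and sum_x h_x <= 1. The function sum_x u(x) h_x minimises
   Q_t among the functions equal to u on K, so Q_t(u,u) is at least the quadratic form with matrix
   Q_t(h_x,h_y) = Q_t(h_x,1_y). As 1_y is in D(L), these entries are computed from L~ h_x at y, and
   the bounds on h_x show that the edge weights and killing term of this trace form dominate t b and
   t c on K. Divide by t, let t tend to infinity and K exhaust V.

   That Q makes sense needs existence and uniqueness of L^(1/2): with B = (1 + L)^(-1),
   R = B^(1/2) and T = (1 - B)^(1/2), the root is R f |-> T f. Any other root S' satisfies
   S' B = T R by uniqueness of bounded positive roots, hence extends R f |-> T f because it is
   closed, and coincides with it because selfadjoint operators are maximal symmetric. *)

theory Submission
  imports Defs
begin

section \<open>Square roots of selfadjoint operators on real Hilbert spaces\<close>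

text \<open>A function in the form domain need be neither in the domain of \<open>L\<close> nor a
  limit of finitely supported functions, so Q(u,u) cannot be read off from L~. Only pairings with
  finitely supported functions are accessible, and the trace form is arranged to require nothing
  else: h_y and 1_y agree on K, hence h_x is Q_t-orthogonal to their difference, and the entry is
  expressed through h_x(y) and L~ h_x at y although h_x itself need not belong to D(L). Off the
  diagonal this leaves -t times a weighted sum of the values of h_x at the neighbours of y, one of
  which may be h_x(x) = 1; the column sums involve only sum_x h_x, which equals 1 at y. These two
  facts are the source of the edge and the killing bounds. The inner product in Q_t supplies
  existence and uniqueness of the minimisers, since Q by itself need not control the norm; its
  contribution disappears after division by t. No spectral theorem enters: the root is built from
  bounded contractions, for which (I - Y)^2 = I - A is a fixed-point equation for Y.\<close>

lemma orthogonal_decomposition_closed_subspace: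
  fixes N :: "'a::{real_inner,banach} set"
  assumes N: "closed N" "subspace N"
  obtains n where "n \<in> N" "\<And>v. v \<in> N \<Longrightarrow> inner (a - n) v = 0"
proof -
  define d where "d = (INF n\<in>N. (norm (a - n))\<^sup>2)"
  have ne: "N \<noteq> {}" using subspace_0[OF N(2)] by auto
  have bb: "bdd_below ((\<lambda>n. (norm (a - n))\<^sup>2) ` N)" by (rule bdd_belowI[of _ 0]) auto
  have d_le: "d \<le> (norm (a - n))\<^sup>2" if "n \<in> N" for n
    unfolding d_def by (rule cINF_lower[OF bb that])
  have "\<exists>n\<in>N. (norm (a - n))\<^sup>2 < d + e" if "e > 0" for e
    using cINF_less_iff[OF ne bb, of "d + e"] that unfolding d_def by auto
  then have "\<forall>k. \<exists>n\<in>N. (norm (a - n))\<^sup>2 < d + inverse (real (Suc k))" by simp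
  then obtain s where s: "\<And>k. s k \<in> N" and sd: "\<And>k. (norm (a - s k))\<^sup>2 < d + inverse (real (Suc k))"
    by metis
  \<comment> \<open>Parallelogram identity for \<open>a - s j\<close> and \<open>a - s k\<close>:
    the midpoint of \<open>s j\<close> and \<open>s k\<close> lies in \<open>N\<close>, so its
    squared distance from \<open>a\<close> is at least \<open>d\<close>, and the excesses of the two
    terms over \<open>d\<close> control their distance from each other.\<close>
  have par: "(norm (s j - s k))\<^sup>2 \<le> 2 * inverse (real (Suc j)) + 2 * inverse (real (Suc k))" for j k
  proof -
    have "(1/2) *\<^sub>R (s j + s k) \<in> N"
      using s N(2) by (simp add: subspace_add subspace_scale)
    from d_le[OF this] have "d \<le> (norm (a - (1/2) *\<^sub>R (s j + s k)))\<^sup>2" .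
    moreover have "(norm (s j - s k))\<^sup>2 = 2 * (norm (a - s j))\<^sup>2 + 2 * (norm (a - s k))\<^sup>2
        - 4 * (norm (a - (1/2) *\<^sub>R (s j + s k)))\<^sup>2"
      by (simp add: power2_norm_eq_inner inner_diff_left inner_diff_right inner_add_left inner_add_right
          inner_commute algebra_simps)
    ultimately show ?thesis using sd[of j] sd[of k] by simp
  qed
  have "Cauchy s"
  proof (rule metric_CauchyI)
    fix e :: real assume e: "e > 0"
    have "e\<^sup>2 / 4 > 0" using e by simp
    then obtain M where M: "inverse (real (Suc M)) < e\<^sup>2 / 4" using reals_Archimedean by blast
    have "dist (s j) (s k) < e" if "j \<ge> M" "k \<ge> M" for j k
    proof -
      have "inverse (real (Suc j)) \<le> inverse (real (Suc M))" "inverse (real (Suc k)) \<le> inverse (real (Suc M))"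
        using that by auto
      then have "(norm (s j - s k))\<^sup>2 < e\<^sup>2" using par[of j k] M by linarith
      then show ?thesis using e by (simp add: dist_norm power2_less_imp_less)
    qed
    then show "\<exists>M. \<forall>m\<ge>M. \<forall>n\<ge>M. dist (s m) (s n) < e" by blast
  qed
  then obtain n where lim: "s \<longlonglongrightarrow> n" using Cauchy_convergent convergent_def by blast
  have nN: "n \<in> N" using N(1) lim s closed_sequentially by blast
  have "(\<lambda>k. (norm (a - s k))\<^sup>2) \<longlonglongrightarrow> (norm (a - n))\<^sup>2" by (intro tendsto_intros lim)
  moreover have "(\<lambda>k. d + inverse (real (Suc k))) \<longlonglongrightarrow> d + 0"
    by (intro tendsto_intros LIMSEQ_inverse_real_of_nat)
  ultimately have "(norm (a - n))\<^sup>2 \<le> d + 0" 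
    by (rule LIMSEQ_le) (use sd less_imp_le in blast)
  then have min: "(norm (a - n))\<^sup>2 \<le> (norm (a - q))\<^sup>2" if "q \<in> N" for q using d_le[OF that] by linarith
  have "inner (a - n) v = 0" if v: "v \<in> N" for v
  proof (cases "v = 0")
    case False
    have sq: "(norm (w - r *\<^sub>R v))\<^sup>2 = (norm w)\<^sup>2 - 2 * r * inner w v + r\<^sup>2 * inner v v" for w r
      by (simp add: power2_norm_eq_inner inner_diff_left inner_diff_right inner_commute[of v w]
          power2_eq_square[of r] algebra_simps)
    \<comment> \<open>This \<open>t\<close> minimises the quadratic polynomial \<open>sq\<close> in
      \<open>r\<close> for \<open>w = a - n\<close>. The decrease it would achieve is the square of
      \<open>inner (a - n) v\<close> over \<open>inner v v\<close>, which minimality of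
      \<open>n\<close> forces to vanish.\<close>
    define t where "t = inner (a - n) v / inner v v"
    have "(norm (a - n))\<^sup>2 \<le> (norm (a - (n + t *\<^sub>R v)))\<^sup>2"
      using min v nN N(2) by (simp add: subspace_add subspace_scale)
    also have "\<dots> = (norm ((a - n) - t *\<^sub>R v))\<^sup>2" by (simp add: algebra_simps)
    also have "\<dots> = (norm (a - n))\<^sup>2 - 2 * t * inner (a - n) v + t\<^sup>2 * inner v v"
      by (rule sq)
    also have "\<dots> = (norm (a - n))\<^sup>2 - (inner (a - n) v)\<^sup>2 / inner v v"
      using False by (simp add: t_def power2_eq_square)
    finally have "(inner (a - n) v)\<^sup>2 / inner v v \<le> 0" by simp
    moreover have "inner v v > 0" using False by simp
    ultimately show ?thesis by (simp add: divide_le_0_iff)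
  qed simp
  then show ?thesis using that nN by blast
qed

text \<open>With I - Y as the root of I - A, the equation (I - Y)^2 = I - A becomes Y = (A + Y^2)/2,
  which is solved by iterating from 0. Each iterate is a polynomial in A, hence symmetric and
  commuting with everything that commutes with A, and both properties survive the limit. The bound
  on Y is what makes I - Y nonnegative.\<close>

lemma contraction_sqrt_exists:
  fixes A :: "'a::{real_inner,banach} \<Rightarrow>\<^sub>L 'a"
  assumes nA: "norm A \<le> 1" and sA: "\<And>f g. inner (A f) g = inner f (A g)"
  obtains Y :: "'a \<Rightarrow>\<^sub>L 'a" where "norm Y \<le> 1" "\<And>f g. inner (Y f) g = inner f (Y g)"
    "\<And>f. f - Y f - Y (f - Y f) = f - A f"
    "\<And>C. C o\<^sub>L A = A o\<^sub>L C \<Longrightarrow> C o\<^sub>L Y = Y o\<^sub>L C"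
proof -
  interpret o: bounded_bilinear "(o\<^sub>L) :: ('a \<Rightarrow>\<^sub>L 'a) \<Rightarrow> ('a \<Rightarrow>\<^sub>L 'a) \<Rightarrow> _"
    by (rule bounded_bilinear_blinfun_compose)
  define X where "X = rec_nat (0 :: 'a \<Rightarrow>\<^sub>L 'a) (\<lambda>_ Z. (1/2) *\<^sub>R (A + (Z o\<^sub>L Z)))"
  define y where "y = rec_nat (0::real) (\<lambda>_ z. (1 + z * z) / 2)"
  have X0: "X 0 = 0" and XS: "\<And>n. X (Suc n) = (1/2) *\<^sub>R (A + (X n o\<^sub>L X n))" by (auto simp: X_def)
  have y0: "y 0 = 0" and yS: "\<And>n. y (Suc n) = (1 + y n * y n) / 2" by (auto simp: y_def)
  have yb: "0 \<le> y n \<and> y n \<le> 1" for n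
  proof (induction n)
    case (Suc n)
    then have "y n * y n \<le> 1 * 1" by (intro mult_mono) auto
    then show ?case by (simp add: yS)
  qed (simp add: y0)
  have Xb: "norm (X n) \<le> y n" for n
  proof (induction n)
    case (Suc n)
    have "norm (A + (X n o\<^sub>L X n)) \<le> norm A + norm (X n o\<^sub>L X n)" by (rule norm_triangle_ineq)
    also have "norm (X n o\<^sub>L X n) \<le> norm (X n) * norm (X n)" by (rule norm_blinfun_compose)
    also have "\<dots> \<le> y n * y n" using Suc yb by (intro mult_mono) auto
    finally show ?case using nA by (simp add: XS yS)
  qed (simp add: X0 y0)
  \<comment> \<open>The scalar iteration y (the case A = 1) majorises X, so no series expansion of the root is needed.\<close>
  have step: "norm (X (Suc n) - X n) \<le> y (Suc n) - y n" for n
  proof (induction n)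
    case 0
    then show ?case using nA by (simp add: XS X0 yS y0)
  next
    case (Suc n)
    let ?D = "X (Suc n) - X n"
    have "X (Suc (Suc n)) - X (Suc n) = (1/2) *\<^sub>R ((X (Suc n) o\<^sub>L X (Suc n)) - (X n o\<^sub>L X n))"
      unfolding XS[of "Suc n"] XS[of n] by (simp add: scaleR_diff_right[symmetric] del: scaleR_half_double)
    also have "(X (Suc n) o\<^sub>L X (Suc n)) - (X n o\<^sub>L X n) = (X (Suc n) o\<^sub>L ?D) + (?D o\<^sub>L X n)"
      by (simp add: o.diff_left o.diff_right)
    finally have eq: "X (Suc (Suc n)) - X (Suc n) = (1/2) *\<^sub>R ((X (Suc n) o\<^sub>L ?D) + (?D o\<^sub>L X n))" .
    have "norm ((X (Suc n) o\<^sub>L ?D) + (?D o\<^sub>L X n)) \<le> norm (X (Suc n)) * norm ?D + norm ?D * norm (X n)"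
      by (intro order_trans[OF norm_triangle_ineq] add_mono norm_blinfun_compose)
    also have "\<dots> \<le> y (Suc n) * (y (Suc n) - y n) + (y (Suc n) - y n) * y n"
    proof -
      have "0 \<le> y (Suc n) - y n" using Suc norm_ge_zero order_trans by blast
      then show ?thesis using Suc Xb[of n] Xb[of "Suc n"] yb by (intro add_mono mult_mono) auto
    qed
    also have "\<dots> = 2 * (y (Suc (Suc n)) - y (Suc n))"
      unfolding yS[of "Suc n"] using yS[of n] by (simp add: algebra_simps)
    finally show ?case unfolding eq by simp
  qed
  have tele: "norm (X (n + k) - X n) \<le> y (n + k) - y n" for n k
  proof (induction k)
    case (Suc k)
    have "norm (X (n + Suc k) - X n) \<le> norm (X (Suc (n + k)) - X (n + k)) + norm (X (n + k) - X n)"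
      using norm_triangle_ineq[of "X (Suc (n + k)) - X (n + k)" "X (n + k) - X n"] by simp
    then show ?case using step[of "n + k"] Suc by simp
  qed simp
  have "y n \<le> y (Suc n)" for n using step[of n] norm_ge_zero[of "X (Suc n) - X n"] by linarith
  then have "incseq y" by (rule incseq_SucI)
  then have "convergent y" using yb Bseq_mono_convergent[of y] 
    by (metis BseqI' abs_of_nonneg incseqD real_norm_def)
  then have "Cauchy y" by (simp add: Cauchy_convergent_iff)
  have "Cauchy X"
  proof (rule metric_CauchyI)
    fix e :: real assume "e > 0"
    then obtain M where M: "\<And>j k. j \<ge> M \<Longrightarrow> k \<ge> M \<Longrightarrow> dist (y j) (y k) < e"
      using \<open>Cauchy y\<close> unfolding Cauchy_def by metis
    have *: "dist (X j) (X k) < e" if "M \<le> k" "k \<le> j" for j k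
      using tele[of k "j - k"] M[of j k] that by (auto simp: dist_norm)
    have "dist (X j) (X k) < e" if "M \<le> k" "M \<le> j" for j k
      using *[of k j] *[of j k] that by (cases "k \<le> j") (auto simp: dist_commute)
    then show "\<exists>M. \<forall>m\<ge>M. \<forall>n\<ge>M. dist (X m) (X n) < e" by blast
  qed
  then obtain Y where Y: "X \<longlonglongrightarrow> Y" using Cauchy_convergent convergent_def by blast
  have Xap: "(\<lambda>n. X n f) \<longlonglongrightarrow> Y f" for f by (intro tendsto_intros Y)
  have "(\<lambda>n. X (Suc n)) \<longlonglongrightarrow> (1/2) *\<^sub>R (A + (Y o\<^sub>L Y))"
    unfolding XS by (intro tendsto_intros o.tendsto Y)
  then have fixp: "Y = (1/2) *\<^sub>R (A + (Y o\<^sub>L Y))" by (rule LIMSEQ_unique[OF LIMSEQ_Suc[OF Y]])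
  have "norm Y \<le> 1"
    by (rule LIMSEQ_le_const2[OF tendsto_norm[OF Y]]) (use Xb yb order_trans in blast)
  moreover have "inner (Y f) g = inner f (Y g)" for f g
  proof -
    have "inner (X n f) g = inner f (X n g)" for n
      by (induction n arbitrary: f g)
        (simp_all add: X0 XS blinfun.bilinear_simps inner_add_left inner_add_right sA)
    then have "(\<lambda>n. inner (X n f) g) \<longlonglongrightarrow> inner f (Y g)" by (auto intro!: tendsto_intros Xap)
    moreover have "(\<lambda>n. inner (X n f) g) \<longlonglongrightarrow> inner (Y f) g" by (intro tendsto_intros Xap)
    ultimately show ?thesis using LIMSEQ_unique by blast
  qed
  moreover have "f - Y f - Y (f - Y f) = f - A f" for f
  proof -
    have "Y f = (1/2) *\<^sub>R (A f + Y (Y f))"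
      using arg_cong[OF fixp, of "\<lambda>Z. blinfun_apply Z f"] by (simp add: blinfun.bilinear_simps)
    then have "2 *\<^sub>R Y f = A f + Y (Y f)" by (metis scaleR_half_double scaleR_2 scaleR_add_right)
    then show ?thesis by (simp add: blinfun.bilinear_simps algebra_simps scaleR_2)
  qed
  moreover have "C o\<^sub>L Y = Y o\<^sub>L C" if C: "C o\<^sub>L A = A o\<^sub>L C" for C
  proof -
    have "C o\<^sub>L X n = X n o\<^sub>L C" for n
    proof (induction n)
      case (Suc n)
      have "C (X n f) = X n (C f)" for f
        using arg_cong[OF Suc, of "\<lambda>Z. blinfun_apply Z f"] by simp
      then have "C o\<^sub>L (X n o\<^sub>L X n) = (X n o\<^sub>L X n) o\<^sub>L C" by (intro blinfun_eqI) simp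
      then show ?case by (simp add: XS o.add_left o.add_right o.scaleR_left o.scaleR_right C)
    qed (simp add: X0 o.zero_left o.zero_right)
    then have "(\<lambda>n. C o\<^sub>L X n) \<longlonglongrightarrow> (Y o\<^sub>L C)" by (auto intro!: o.tendsto Y)
    moreover have "(\<lambda>n. C o\<^sub>L X n) \<longlonglongrightarrow> (C o\<^sub>L Y)" by (intro o.tendsto Y tendsto_const)
    ultimately show ?thesis using LIMSEQ_unique by blast
  qed
  ultimately show ?thesis using that by blast
qed

text \<open>The last conjunct only places the domain of the adjoint inside \<open>D\<close>; that
  the adjoint acts as \<open>L\<close> there follows from symmetry and density. Values of
  \<open>L\<close> outside \<open>D\<close> are unconstrained, as for the complex operators.\<close>

definition real_selfadjoint :: "'a::real_inner set \<Rightarrow> ('a \<Rightarrow> 'a) \<Rightarrow> bool" where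
  "real_selfadjoint D L \<longleftrightarrow> subspace D \<and> closure D = UNIV \<and>
     (\<forall>u\<in>D. \<forall>v\<in>D. \<forall>a. L (u + a *\<^sub>R v) = L u + a *\<^sub>R L v) \<and>
     (\<forall>u\<in>D. \<forall>v\<in>D. inner (L u) v = inner u (L v)) \<and>
     (\<forall>v w. (\<forall>u\<in>D. inner (L u) v = inner u w) \<longrightarrow> v \<in> D)"

definition nonneg_on :: "'a::real_inner set \<Rightarrow> ('a \<Rightarrow> 'a) \<Rightarrow> bool" where
  "nonneg_on D L \<longleftrightarrow> (\<forall>u\<in>D. 0 \<le> inner (L u) u)"

lemma dense_inner_zero:
  fixes D :: "'a::real_inner set"
  assumes "closure D = UNIV" "\<And>u. u \<in> D \<Longrightarrow> inner u v = 0"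
  shows "v = 0"
proof -
  obtain x where "\<And>n. x n \<in> D" "x \<longlonglongrightarrow> v"
    using assms(1) closure_sequential[of v D] by auto
  then have "(\<lambda>n. inner (x n) v) \<longlonglongrightarrow> inner v v" by (intro tendsto_intros)
  moreover have "(\<lambda>n. inner (x n) v) = (\<lambda>n. 0)" using assms(2) \<open>\<And>n. x n \<in> D\<close> by auto
  ultimately have "inner v v = 0" using LIMSEQ_unique tendsto_const by metis
  then show ?thesis by simp
qed

section \<open>Unbounded selfadjoint operators: adjoint, closed graph and the resolvent at
  -1\<close>

context
  fixes D :: "'a::{real_inner,banach} set" and L :: "'a \<Rightarrow> 'a"
  assumes sa: "real_selfadjoint D L"
begin

lemma sa_sub: "subspace D" and sa_dense: "closure D = UNIV"
  and sa_lin: "\<And>u v a. u \<in> D \<Longrightarrow> v \<in> D \<Longrightarrow> L (u + a *\<^sub>R v) = L u + a *\<^sub>R L v"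
  and sa_sym: "\<And>u v. u \<in> D \<Longrightarrow> v \<in> D \<Longrightarrow> inner (L u) v = inner u (L v)"
  and sa_max: "\<And>v w. (\<And>u. u \<in> D \<Longrightarrow> inner (L u) v = inner u w) \<Longrightarrow> v \<in> D"
  using sa unfolding real_selfadjoint_def by blast+

lemma sa_0: "0 \<in> D" "L 0 = 0"
proof -
  show "0 \<in> D" using sa_sub by (rule subspace_0)
  then show "L 0 = 0" using sa_lin[of 0 0 1] by simp
qed

lemma sa_add: "u \<in> D \<Longrightarrow> v \<in> D \<Longrightarrow> L (u + v) = L u + L v" using sa_lin[of u v 1] by simp
lemma sa_scale: "u \<in> D \<Longrightarrow> L (a *\<^sub>R u) = a *\<^sub>R L u" using sa_lin[of 0 u a] sa_0 by simp
lemma sa_diff: "u \<in> D \<Longrightarrow> v \<in> D \<Longrightarrow> L (u - v) = L u - L v" using sa_lin[of u v "-1"] by simp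

lemma sa_adjoint:
  assumes "\<And>u. u \<in> D \<Longrightarrow> inner (L u) v = inner u w"
  shows "v \<in> D" "L v = w"
proof -
  show v: "v \<in> D" using sa_max assms by blast
  have "inner u (L v - w) = 0" if "u \<in> D" for u
    using assms[OF that] sa_sym[OF that v] by (simp add: inner_diff_right)
  then have "L v - w = 0" using dense_inner_zero sa_dense by blast
  then show "L v = w" by simp
qed

text \<open>The symmetry relation between \<open>x n\<close> and a fixed \<open>v\<close> in
  \<open>D\<close> passes to the limit and exhibits \<open>w\<close> as the adjoint image of
  \<open>u\<close>.\<close>

lemma sa_closed_graph:
  assumes "\<And>n. x n \<in> D" "x \<longlonglongrightarrow> u" "(\<lambda>n. L (x n)) \<longlonglongrightarrow> w"
  shows "u \<in> D" "L u = w"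
proof -
  have *: "inner (L v) u = inner v w" if "v \<in> D" for v
  proof -
    have "(\<lambda>n. inner (L v) (x n)) \<longlonglongrightarrow> inner (L v) u" by (intro tendsto_intros assms)
    moreover have "(\<lambda>n. inner v (L (x n))) \<longlonglongrightarrow> inner v w" by (intro tendsto_intros assms)
    moreover have "(\<lambda>n. inner (L v) (x n)) = (\<lambda>n. inner v (L (x n)))"
      using assms(1) sa_sym that by auto
    ultimately show ?thesis using LIMSEQ_unique by metis
  qed
  show "u \<in> D" "L u = w" using sa_adjoint[OF *] by auto
qed

lemma sa_closed_graph_image:
  assumes W: "closed W" "subspace W"
  shows "closed ((\<lambda>v. (v, L v)) ` (D \<inter> W))" "subspace ((\<lambda>v. (v, L v)) ` (D \<inter> W))"
proof -
  let ?N = "(\<lambda>v. (v, L v)) ` (D \<inter> W)"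
  show "closed ?N"
    unfolding closed_sequential_limits
  proof (intro allI impI, elim conjE)
    fix z l assume z: "\<forall>n. z n \<in> ?N" and lim: "z \<longlonglongrightarrow> l"
    have x: "fst (z n) \<in> D" "fst (z n) \<in> W" and y: "snd (z n) = L (fst (z n))" for n
      using z[rule_format, of n] by auto
    have l1: "(\<lambda>n. fst (z n)) \<longlonglongrightarrow> fst l" and "(\<lambda>n. snd (z n)) \<longlonglongrightarrow> snd l"
      using lim by (auto intro: tendsto_intros)
    then have "(\<lambda>n. L (fst (z n))) \<longlonglongrightarrow> snd l" using y by simp
    from sa_closed_graph[OF x(1) l1 this] have "fst l \<in> D" "L (fst l) = snd l" by auto
    moreover have "fst l \<in> W" using closed_sequentially[OF W(1) _ l1] x(2) by blast
    ultimately show "l \<in> ?N" by (intro image_eqI[of _ _ "fst l"]) auto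
  qed
  show "subspace ?N"
  proof (rule subspaceI)
    show "0 \<in> ?N" using sa_0 subspace_0[OF W(2)] by (intro image_eqI[of _ _ 0]) (auto simp: zero_prod_def)
  next
    fix p q assume "p \<in> ?N" "q \<in> ?N"
    then obtain u v where "p = (u, L u)" "q = (v, L v)" "u \<in> D \<inter> W" "v \<in> D \<inter> W" by auto
    then show "p + q \<in> ?N" using sa_add sa_sub W(2)
      by (intro image_eqI[of _ _ "u + v"]) (auto simp: subspace_add)
  next
    fix a p assume "p \<in> ?N"
    then obtain u where "p = (u, L u)" "u \<in> D \<inter> W" by auto
    then show "a *\<^sub>R p \<in> ?N" using sa_scale sa_sub W(2)
      by (intro image_eqI[of _ _ "a *\<^sub>R u"]) (auto simp: subspace_scale)
  qed
qed

text \<open>On the graph of \<open>L\<close> the inner product of the product space is <u,v> +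
  <Lu,Lv>. Projecting (a, L a) orthogonally onto the graph over \<open>D \<inter> W\<close>
  therefore solves a Dirichlet problem: \<open>h\<close> minimises this energy in the class of
  \<open>a\<close> modulo \<open>W\<close>. It is later applied to a multiple of the root, with
  \<open>W\<close> the functions vanishing on \<open>K\<close>.\<close>

lemma sa_orthogonal_representative:
  assumes W: "closed W" "subspace W" and a: "a \<in> D"
  obtains h where "h \<in> D" "h - a \<in> W" "\<And>v. v \<in> D \<Longrightarrow> v \<in> W \<Longrightarrow> inner h v + inner (L h) (L v) = 0"
proof -
  obtain n where n: "n \<in> (\<lambda>v. (v, L v)) ` (D \<inter> W)"
    and o: "\<And>v. v \<in> (\<lambda>v. (v, L v)) ` (D \<inter> W) \<Longrightarrow> inner ((a, L a) - n) v = 0"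
    using orthogonal_decomposition_closed_subspace[OF sa_closed_graph_image[OF W]] by metis
  then obtain w where w: "n = (w, L w)" "w \<in> D" "w \<in> W" by auto
  show ?thesis
  proof (rule that[of "a - w"])
    show "a - w \<in> D" using a w sa_sub by (simp add: subspace_diff)
    show "a - w - a \<in> W" using w W(2) by (simp add: subspace_neg)
    show "inner (a - w) v + inner (L (a - w)) (L v) = 0" if "v \<in> D" "v \<in> W" for v
      using o[of "(v, L v)"] that w a by (simp add: sa_diff)
  qed
qed

text \<open>\<open>B\<close> is (I + L)^(-1). Expanding the square of the norm of
  \<open>u + L u\<close> bounds both \<open>u\<close> and \<open>L u\<close> by it. The first bound
  makes the range of I + L closed, and a vector \<open>e\<close> orthogonal to that range would
  satisfy \<open>L e = - e\<close>, which nonnegativity excludes. The two bounds then become the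
  norm bounds on \<open>B\<close> and on I - B, the latter being L B.\<close>

lemma sa_resolvent:
  assumes nn: "nonneg_on D L"
  obtains B :: "'a \<Rightarrow>\<^sub>L 'a" where "norm B \<le> 1" "norm (id_blinfun - B) \<le> 1"
    "\<And>f. B f \<in> D" "\<And>f. L (B f) = f - B f" "\<And>u. u \<in> D \<Longrightarrow> B (u + L u) = u"
    "\<And>f g. inner (B f) g = inner f (B g)"
proof -
  have nn: "0 \<le> inner (L u) u" if "u \<in> D" for u using nn that unfolding nonneg_on_def by blast
  have est: "(norm (u + L u))\<^sup>2 = (norm u)\<^sup>2 + 2 * inner (L u) u + (norm (L u))\<^sup>2" for u
    by (simp add: power2_norm_eq_inner inner_add_left inner_add_right inner_commute[of u "L u"])
  have est1: "norm u \<le> norm (u + L u)" "norm (L u) \<le> norm (u + L u)" if "u \<in> D" for u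
    by (rule power2_le_imp_le; use est[of u] nn[OF that] in simp)+
  define N where "N = (\<lambda>u. u + L u) ` D"
  have "subspace N"
  proof (rule subspaceI)
    show "0 \<in> N" unfolding N_def using sa_0 by (intro image_eqI[of _ _ 0]) auto
  next
    fix p q assume "p \<in> N" "q \<in> N"
    then obtain u v where "p = u + L u" "q = v + L v" "u \<in> D" "v \<in> D" unfolding N_def by auto
    then show "p + q \<in> N" unfolding N_def using sa_add sa_sub
      by (intro image_eqI[of _ _ "u + v"]) (auto simp: subspace_add)
  next
    fix a p assume "p \<in> N"
    then obtain u where "p = u + L u" "u \<in> D" unfolding N_def by auto
    then show "a *\<^sub>R p \<in> N" unfolding N_def using sa_scale sa_sub
      by (intro image_eqI[of _ _ "a *\<^sub>R u"]) (auto simp: subspace_scale scaleR_add_right)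
  qed
  have "closed N"
    unfolding closed_sequential_limits
  proof (intro allI impI, elim conjE)
    fix z l assume "\<forall>n. z n \<in> N" and lim: "z \<longlonglongrightarrow> l"
    then have "\<forall>n. \<exists>u\<in>D. z n = u + L u" unfolding N_def by auto
    then obtain x where x: "\<And>n. x n \<in> D" "\<And>n. z n = x n + L (x n)" by metis
    have "norm (x i - x j) \<le> norm (z i - z j)" for i j
      using est1(1)[of "x i - x j"] x sa_sub by (simp add: subspace_diff sa_diff algebra_simps)
    then have "Cauchy x" using LIMSEQ_imp_Cauchy[OF lim] unfolding Cauchy_def dist_norm
      by (meson order_le_less_trans)
    then obtain u where u: "x \<longlonglongrightarrow> u" using Cauchy_convergent convergent_def by blast
    have "(\<lambda>n. z n - x n) \<longlonglongrightarrow> l - u" by (intro tendsto_intros lim u)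
    then have "(\<lambda>n. L (x n)) \<longlonglongrightarrow> l - u" using x(2) by simp
    from sa_closed_graph[OF x(1) u this] show "l \<in> N" unfolding N_def by (intro image_eqI[of _ _ u]) auto
  qed
  have surj: "\<exists>u\<in>D. u + L u = f" for f
  proof -
    obtain n where n: "n \<in> N" and o: "\<And>v. v \<in> N \<Longrightarrow> inner (f - n) v = 0"
      using orthogonal_decomposition_closed_subspace[OF \<open>closed N\<close> \<open>subspace N\<close>] by metis
    define e where "e = f - n"
    have *: "inner (L u) e = inner u (- e)" if "u \<in> D" for u
    proof -
      have "inner e (u + L u) = 0" using o that unfolding N_def e_def by blast
      then show ?thesis by (simp add: inner_add_right inner_commute[of u e] inner_commute[of "L u" e])
    qed
    have "e \<in> D" "L e = - e" using sa_adjoint[OF *] by auto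
    then have "inner e e \<le> 0" using nn[of e] by simp
    then have "e = 0" by (metis inner_eq_zero_iff inner_ge_zero order_antisym)
    then have "f = n" by (simp add: e_def)
    then show ?thesis using n unfolding N_def by auto
  qed
  define G where "G f = (SOME u. u \<in> D \<and> u + L u = f)" for f
  have G: "G f \<in> D" "G f + L (G f) = f" for f
    using someI_ex[of "\<lambda>u. u \<in> D \<and> u + L u = f"] surj[of f] unfolding G_def by blast+
  have inj: "u = v" if "u \<in> D" "v \<in> D" "u + L u = v + L v" for u v
  proof -
    have "norm (u - v) \<le> norm (u - v + L (u - v))" using est1(1) that sa_sub by (simp add: subspace_diff)
    also have "u - v + L (u - v) = 0" using that by (simp add: sa_diff algebra_simps)
    finally show ?thesis by simp
  qed
  have GL: "G (u + L u) = u" if "u \<in> D" for u using inj[OF G(1) that] G(2) by blast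
  have bl: "bounded_linear G"
  proof (rule bounded_linear_intro[where K = 1])
    show "G (x + y) = G x + G y" for x y
    proof (rule inj)
      show "G x + G y \<in> D" using G sa_sub by (simp add: subspace_add)
      have "G x + G y + L (G x + G y) = (G x + L (G x)) + (G y + L (G y))"
        using G(1) by (simp add: sa_add algebra_simps)
      then show "G (x + y) + L (G (x + y)) = G x + G y + L (G x + G y)" using G(2) by simp
    qed (rule G)
    show "G (r *\<^sub>R x) = r *\<^sub>R G x" for r x
    proof (rule inj)
      show "r *\<^sub>R G x \<in> D" using G sa_sub by (simp add: subspace_scale)
      have "r *\<^sub>R G x + L (r *\<^sub>R G x) = r *\<^sub>R (G x + L (G x))"
        using G(1) by (simp add: sa_scale scaleR_add_right)
      then show "G (r *\<^sub>R x) + L (G (r *\<^sub>R x)) = r *\<^sub>R G x + L (r *\<^sub>R G x)" using G(2) by simp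
    qed (rule G)
    show "norm (G x) \<le> norm x * 1" for x using est1(1)[OF G(1)[of x]] G(2)[of x] by simp
  qed
  define B where "B = Blinfun G"
  have BG: "blinfun_apply B = G" unfolding B_def by (rule bounded_linear_Blinfun_apply[OF bl])
  have LB: "L (G f) = f - G f" for f using G(2)[of f] by (metis add_diff_cancel_left')
  show ?thesis
  proof (rule that[of B])
    show "norm B \<le> 1" using est1(1)[OF G(1)] unfolding G(2) by (intro norm_blinfun_bound) (auto simp: BG)
    show "norm (id_blinfun - B) \<le> 1"
      using est1(2)[OF G(1)] unfolding G(2) LB by (intro norm_blinfun_bound) (auto simp: BG blinfun.diff_left)
    show "inner (B f) g = inner f (B g)" for f g
      using sa_sym[OF G(1)[of f] G(1)[of g]] unfolding BG LB
      by (simp add: inner_diff_left inner_diff_right)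
  qed (simp_all add: BG G GL LB)
qed

end

text \<open>Cauchy-Schwarz for the semi-inner product \<open>inner (Q f) g\<close>: a null vector is
  orthogonal to everything, in particular to \<open>Q y\<close>. The proof tests nonnegativity along
  the line \<open>y + t *\<^sub>R z\<close> with \<open>z = Q y\<close>.\<close>

lemma nonneg_symmetric_null_vector:
  fixes Q :: "'a::real_inner \<Rightarrow>\<^sub>L 'a"
  assumes sym: "\<And>f g. inner (Q f) g = inner f (Q g)" and nn: "\<And>f. 0 \<le> inner (Q f) f"
    and y: "inner (Q y) y = 0"
  shows "Q y = 0"
proof -
  define z where "z = Q y"
  define s where "s = inner z z"
  define a where "a = inner (Q z) z"
  have a: "a \<ge> 0" unfolding a_def by (rule nn)
  have quad: "0 \<le> 2 * t * s + t\<^sup>2 * a" for t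
  proof -
    have "0 \<le> inner (Q (y + t *\<^sub>R z)) (y + t *\<^sub>R z)" by (rule nn)
    also have "\<dots> = inner (Q y) y + t * inner (Q y) z + t * inner (Q z) y + t\<^sup>2 * inner (Q z) z"
      by (simp add: blinfun.bilinear_simps inner_add_left inner_add_right power2_eq_square algebra_simps)
    also have "inner (Q z) y = s" using sym[of z y] by (simp add: s_def z_def)
    finally show ?thesis using y by (simp add: a_def s_def z_def)
  qed
  \<comment> \<open>The denominator is \<open>a + 1\<close> rather than \<open>a\<close> because
    \<open>a\<close> may vanish. With this \<open>t\<close> the quadratic is at most
    \<open>t * s\<close>, that is -s^2/(a + 1).\<close>
  define t where "t = - s / (a + 1)"
  have "t\<^sup>2 * a \<le> t\<^sup>2 * (a + 1)" by (intro mult_left_mono) auto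
  also have "\<dots> = t * (t * (a + 1))" by (simp add: power2_eq_square)
  also have "t * (a + 1) = - s" using a by (simp add: t_def)
  finally have "0 \<le> t * s" using quad[of t] by simp
  then have "s\<^sup>2 / (a + 1) \<le> 0" by (simp add: t_def power2_eq_square)
  then have "s = 0" using a by (simp add: divide_le_0_iff)
  then show ?thesis by (simp add: s_def z_def)
qed

lemma blinfun_commute_apply: "C o\<^sub>L A = A o\<^sub>L C \<longleftrightarrow> (\<forall>f. C (A f) = A (C f))"
proof
  assume "C o\<^sub>L A = A o\<^sub>L C"
  from arg_cong[OF this, of blinfun_apply] show "\<forall>f. C (A f) = A (C f)" by (simp add: fun_eq_iff)
qed (auto intro: blinfun_eqI)

text \<open>The equation for \<open>D\<close> says that \<open>D\<close> is the natural domain of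
  the product of \<open>S\<close> with itself, so the square of \<open>S\<close> equals
  \<open>L\<close> as an unbounded operator instead of merely extending it.\<close>

definition nonneg_sqrt :: "'a::real_inner set \<Rightarrow> ('a \<Rightarrow> 'a) \<Rightarrow> 'a set \<Rightarrow> ('a \<Rightarrow> 'a) \<Rightarrow> bool" where
  "nonneg_sqrt D L DS S \<longleftrightarrow> real_selfadjoint DS S \<and> nonneg_on DS S \<and>
     D = {u \<in> DS. S u \<in> DS} \<and> (\<forall>u\<in>D. S (S u) = L u)"

text \<open>The second conclusion is there for multiplication by i: over real scalars it is what
  later shows that the root of a complex linear operator is complex linear. The third compares
  values on the domain only, since elsewhere they are arbitrary.\<close>

lemma nonneg_sqrt_exists:
  fixes D :: "'a::{real_inner,banach} set" and L :: "'a \<Rightarrow> 'a"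
  assumes sa: "real_selfadjoint D L" and nn: "nonneg_on D L"
  obtains DS S where "nonneg_sqrt D L DS S"
    "\<forall>J :: 'a \<Rightarrow>\<^sub>L 'a. (\<forall>u\<in>D. J u \<in> D \<and> L (J u) = J (L u)) \<longrightarrow> (\<forall>u\<in>DS. J u \<in> DS \<and> S (J u) = J (S u))"
    "\<forall>DS' S'. nonneg_sqrt D L DS' S' \<longrightarrow> DS' = DS \<and> (\<forall>u\<in>DS. S' u = S u)"
proof -
  note D = sa_0[OF sa] sa_sub[OF sa]
  obtain B :: "'a \<Rightarrow>\<^sub>L 'a" where nB: "norm B \<le> 1" and nB': "norm (id_blinfun - B) \<le> 1"
    and BD: "\<And>f. B f \<in> D" and LB: "\<And>f. L (B f) = f - B f" and BL: "\<And>u. u \<in> D \<Longrightarrow> B (u + L u) = u"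
    and Bs: "\<And>f g. inner (B f) g = inner f (B g)"
    using sa_resolvent[OF sa nn] by metis
  have Bs': "inner ((id_blinfun - B) f) g = inner f ((id_blinfun - B) g)" for f g
    by (simp add: blinfun.bilinear_simps inner_diff_left inner_diff_right Bs)
  obtain Y :: "'a \<Rightarrow>\<^sub>L 'a" where nY: "norm Y \<le> 1" and Ys: "\<And>f g. inner (Y f) g = inner f (Y g)"
    and YY: "\<And>f. f - Y f - Y (f - Y f) = f - (id_blinfun - B) f"
    and Yc: "\<And>C. C o\<^sub>L (id_blinfun - B) = (id_blinfun - B) o\<^sub>L C \<Longrightarrow> C o\<^sub>L Y = Y o\<^sub>L C"
    using contraction_sqrt_exists[OF nB' Bs'] by metis
  obtain Z :: "'a \<Rightarrow>\<^sub>L 'a" where nZ: "norm Z \<le> 1" and Zs: "\<And>f g. inner (Z f) g = inner f (Z g)"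
    and ZZ: "\<And>f. f - Z f - Z (f - Z f) = f - B f"
    and Zc: "\<And>C. C o\<^sub>L B = B o\<^sub>L C \<Longrightarrow> C o\<^sub>L Z = Z o\<^sub>L C"
    using contraction_sqrt_exists[OF nB Bs] by metis
  obtain W :: "'a \<Rightarrow>\<^sub>L 'a" where Ws: "\<And>f g. inner (W f) g = inner f (W g)"
    and WW: "\<And>f. f - W f - W (f - W f) = f - Z f"
    and Wc: "\<And>C. C o\<^sub>L Z = Z o\<^sub>L C \<Longrightarrow> C o\<^sub>L W = W o\<^sub>L C"
    using contraction_sqrt_exists[OF nZ Zs] by metis
  \<comment> \<open>These are the roots of B, of I - B and of T, each in the form I minus a
    contraction or symmetric operator delivered by \<open>contraction_sqrt_exists\<close>. The extra
    root \<open>K\<close> makes the product of T and R visibly nonnegative: <T f, R f> = <K f, R K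
    f>.\<close>
  define R T K where "R = id_blinfun - Y" and "T = id_blinfun - Z" and "K = id_blinfun - W"
  have app: "R f = f - Y f" "T f = f - Z f" "K f = f - W f" for f
    by (simp_all add: R_def T_def K_def blinfun.diff_left)
  have RR: "R (R f) = B f" for f using YY[of f] by (simp add: app blinfun.bilinear_simps)
  have TT: "T (T f) = f - B f" for f using ZZ[of f] by (simp add: app)
  have KK: "K (K f) = T f" for f using WW[of f] by (simp add: app)
  have Rs: "inner (R f) g = inner f (R g)" for f g by (simp add: app inner_diff_left inner_diff_right Ys)
  have Ts: "inner (T f) g = inner f (T g)" for f g by (simp add: app inner_diff_left inner_diff_right Zs)
  have Ks: "inner (K f) g = inner f (K g)" for f g by (simp add: app inner_diff_left inner_diff_right Ws)
  have Rc: "C (R f) = R (C f)" if "\<And>f. C (B f) = B (C f)" for C :: "'a \<Rightarrow>\<^sub>L 'a" and f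
    using Yc[of C] that by (simp add: blinfun_commute_apply app blinfun.bilinear_simps)
  have Tc: "C (T f) = T (C f)" if "\<And>f. C (B f) = B (C f)" for C :: "'a \<Rightarrow>\<^sub>L 'a" and f
    using Zc[of C] that by (simp add: blinfun_commute_apply app blinfun.bilinear_simps)
  have Kc: "C (K f) = K (C f)" if "\<And>f. C (B f) = B (C f)" for C :: "'a \<Rightarrow>\<^sub>L 'a" and f
    using Wc[of C] Zc[of C] that by (simp add: blinfun_commute_apply app blinfun.bilinear_simps)
  have RB: "R (B f) = B (R f)" for f using Rc[of B] by simp
  have RT: "R (T f) = T (R f)" for f using Tc[of R, OF RB] .
  have RK: "R (K f) = K (R f)" for f using Kc[of R, OF RB] .
  have Rnn: "0 \<le> inner (R f) f" for f
  proof -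
    have "inner (Y f) f \<le> norm (Y f) * norm f" by (rule norm_cauchy_schwarz)
    also have "\<dots> \<le> (norm Y * norm f) * norm f" by (intro mult_right_mono norm_blinfun) auto
    also have "\<dots> \<le> 1 * (norm f * norm f)" using nY by (simp only: mult.assoc) (intro mult_right_mono, auto)
    finally show ?thesis by (simp add: app inner_diff_left dot_square_norm power2_eq_square)
  qed
  have TRnn: "0 \<le> inner (T f) (R f)" for f
  proof -
    have "inner (T f) (R f) = inner (K f) (R (K f))" by (simp add: KK[symmetric] Ks RK)
    then show ?thesis using Rnn[of "K f"] by (simp add: Rs)
  qed
  have Rinj: "inj R"
  proof (rule injI)
    fix f g assume "R f = R g"
    then have "R (f - g) = 0" by (simp add: blinfun.diff_right)
    then have 0: "B (f - g) = 0" by (metis RR blinfun.zero_right)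
    then show "f = g" using LB[of "f - g"] D(2) by simp
  qed
  define DS where "DS = range R"
  define S where "S u = T (inv R u)" for u
  have SR: "S (R f) = T f" for f using Rinj by (simp add: S_def)
  have DS_D: "D \<subseteq> DS"
  proof
    fix u assume "u \<in> D"
    then have "u = R (R (u + L u))" using BL RR by metis
    then show "u \<in> DS" unfolding DS_def by blast
  qed
  have dense: "closure DS = UNIV" using closure_mono[OF DS_D] sa_dense[OF sa] by auto
  have saS: "real_selfadjoint DS S"
    unfolding real_selfadjoint_def
  proof (intro conjI ballI allI impI)
    show "subspace DS" unfolding DS_def
      by (intro linear_subspace_image bounded_linear.linear[OF blinfun.bounded_linear_right]) auto
    show "closure DS = UNIV" by (rule dense)
  next
    fix u v a assume "u \<in> DS" "v \<in> DS"
    then obtain f g where fg: "u = R f" "v = R g" unfolding DS_def by blast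
    then have "u + a *\<^sub>R v = R (f + a *\<^sub>R g)" by (simp add: blinfun.bilinear_simps)
    then have "S (u + a *\<^sub>R v) = T (f + a *\<^sub>R g)" by (simp only: SR)
    then show "S (u + a *\<^sub>R v) = S u + a *\<^sub>R S v" by (simp add: fg SR blinfun.bilinear_simps)
  next
    fix u v assume "u \<in> DS" "v \<in> DS"
    then obtain f g where "u = R f" "v = R g" unfolding DS_def by blast
    then show "inner (S u) v = inner u (S v)" by (simp add: SR Rs Ts RT)
  next
    fix v w assume H: "\<forall>u\<in>DS. inner (S u) v = inner u w"
    have "T v = R w"
    proof -
      have "inner f (T v - R w) = 0" for f
        using H[rule_format, of "R f"] by (simp add: DS_def SR inner_diff_right Ts Rs)
      from this[of "T v - R w"] show ?thesis by simp
    qed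
    \<comment> \<open>The identity R R + T T = I replaces functional calculus: given T v = R w and
      commutation of R with T, it factors \<open>v\<close> through R and so puts it in the range.
      The same identity recovers \<open>D\<close> in \<open>domS\<close>.\<close>
    have "v = R (R v) + T (T v)" by (simp add: RR TT)
    also have "\<dots> = R (R v + T w)" by (simp add: \<open>T v = R w\<close> RT[symmetric] blinfun.bilinear_simps)
    finally show "v \<in> DS" unfolding DS_def by blast
  qed
  have nnS: "nonneg_on DS S" unfolding nonneg_on_def DS_def by (auto simp: SR TRnn)
  have domS: "D = {u \<in> DS. S u \<in> DS}"
  proof (intro set_eqI iffI)
    fix u assume u: "u \<in> D"
    then have "u = R (R (u + L u))" using BL RR by metis
    then have "S u = R (T (u + L u))" using SR RT by metis
    then show "u \<in> {u \<in> DS. S u \<in> DS}" using DS_D u DS_def by auto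
  next
    fix u assume "u \<in> {u \<in> DS. S u \<in> DS}"
    then obtain f g where f: "u = R f" and "S u = R g" unfolding DS_def by blast
    then have g: "T f = R g" by (simp add: SR)
    have "f = R (R f) + T (T f)" by (simp add: RR TT)
    also have "\<dots> = R (R f + T g)" by (simp add: g RT[symmetric] blinfun.bilinear_simps)
    finally have "u = B (R f + T g)" using f RR by metis
    then show "u \<in> D" using BD by simp
  qed
  have sqS: "S (S u) = L u" if "u \<in> D" for u
  proof -
    define f where "f = u + L u"
    have u: "u = R (R f)" unfolding RR f_def using BL that by simp
    then have "S (S u) = T (T f)" by (simp add: SR RT[symmetric])
    also have "\<dots> = L u" using BL[OF that] by (simp add: TT f_def)
    finally show ?thesis .
  qed
  have com: "\<forall>u\<in>DS. J u \<in> DS \<and> S (J u) = J (S u)"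
    if J: "\<And>u. u \<in> D \<Longrightarrow> J u \<in> D" "\<And>u. u \<in> D \<Longrightarrow> L (J u) = J (L u)" for J :: "'a \<Rightarrow>\<^sub>L 'a"
  proof -
    have JB: "J (B f) = B (J f)" for f
    proof -
      have "J (B f) + L (J (B f)) = J f" using J(2)[OF BD[of f]] by (simp add: LB blinfun.bilinear_simps)
      then show ?thesis using BL[OF J(1)[OF BD[of f]]] by simp
    qed
    show ?thesis unfolding DS_def using Rc[of J, OF JB] Tc[of J, OF JB] by (auto simp: SR)
  qed
  have uniq: "DS' = DS \<and> (\<forall>u\<in>DS. S' u = S u)"
    if sa': "real_selfadjoint DS' S'" and nn': "nonneg_on DS' S'" and dom': "D = {u \<in> DS'. S' u \<in> DS'}"
      and sq': "\<And>u. u \<in> D \<Longrightarrow> S' (S' u) = L u" for DS' S'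
  proof -
    note sym' = sa_sym[OF sa'] and sub' = sa_sub[OF sa']
    have nn': "0 \<le> inner (S' u) u" if "u \<in> DS'" for u using nn' that unfolding nonneg_on_def by blast
    have BD': "B f \<in> DS'" "S' (B f) \<in> DS'" for f using BD[of f] dom' by auto
    have SSB: "S' (S' (B f)) = f - B f" for f using sq'[OF BD] LB by simp
    \<comment> \<open>A competing root commutes with the resolvent: \<open>?y\<close> lies in
      \<open>D\<close> and \<open>?y + L ?y = S' w\<close>, while \<open>B\<close> inverts I +
      L.\<close>
    have SB: "S' (B w) = B (S' w)" if w: "w \<in> DS'" for w
    proof -
      let ?y = "S' (B w)"
      have "S' ?y \<in> DS'" using SSB w BD' sub' by (simp add: subspace_diff)
      then have yD: "?y \<in> D" using dom' BD' by auto
      have "L ?y = S' (w - B w)" using sq'[OF yD] SSB by simp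
      also have "\<dots> = S' w - ?y" using sa_diff[OF sa' w BD'(1)] .
      finally show ?thesis using BL[OF yD] by simp
    qed
    \<comment> \<open>This writes every vector through elements on which the symmetry of
      \<open>S'\<close> may be invoked, and so yields symmetry and nonnegativity of the everywhere
      defined operator S' B.\<close>
    have split: "f = B f + S' (S' (B f))" for f by (simp add: SSB)
    have Psym: "inner (S' (B f)) g = inner f (S' (B g))" for f g
    proof -
      have "inner (S' (B f)) g = inner (S' (B f)) (B g) + inner (S' (B f)) (S' (S' (B g)))"
        by (subst split[of g]) (rule inner_add_right)
      also have "\<dots> = inner (B f) (S' (B g)) + inner (S' (S' (B f))) (S' (B g))"
        by (simp only: sym' BD')
      also have "\<dots> = inner f (S' (B g))"
        by (subst (3) split[of f]) (rule inner_add_left[symmetric])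
      finally show ?thesis .
    qed
    have Pnn: "0 \<le> inner (S' (B f)) f" for f
    proof -
      have "inner (S' (B f)) f = inner (S' (B f)) (B f) + inner (S' (B f)) (S' (S' (B f)))"
        by (subst (2) split[of f]) (rule inner_add_right)
      also have "\<dots> = inner (S' (B f)) (B f) + inner (S' (S' (B f))) (S' (B f))"
        by (simp only: sym' BD')
      also have "\<dots> \<ge> 0" by (intro add_nonneg_nonneg nn' BD')
      finally show ?thesis .
    qed
    \<comment> \<open>S' B squares to B - B B, exactly as the product of T and R does. Comparing
      these two bounded roots replaces a comparison of unbounded operators, and the formula for the
      square also bounds S' B by 1.\<close>
    have PP: "S' (B (S' (B f))) = B f - B (B f)" for f
      using SB[OF BD'(1)[of f]] SSB[of "B f"] by simp
    have bl: "bounded_linear (\<lambda>f. S' (B f))"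
    proof (rule bounded_linear_intro[where K = 1])
      show "S' (B (x + y)) = S' (B x) + S' (B y)" for x y
        using sa_add[OF sa' BD'(1) BD'(1)] by (simp add: blinfun.bilinear_simps)
      show "S' (B (r *\<^sub>R x)) = r *\<^sub>R S' (B x)" for r x
        using sa_scale[OF sa' BD'(1)] by (simp add: blinfun.bilinear_simps)
      show "norm (S' (B f)) \<le> norm f * 1" for f
      proof (rule power2_le_imp_le)
        have "(norm (S' (B f)))\<^sup>2 = inner f (S' (B (S' (B f))))" by (simp add: power2_norm_eq_inner Psym)
        also have "\<dots> = inner (B f) (f - B f)" by (simp add: PP inner_diff_right Bs)
        also have "\<dots> \<le> norm (B f) * norm ((id_blinfun - B) f)"
          using norm_cauchy_schwarz by (simp add: blinfun.diff_left)
        also have "\<dots> \<le> (norm B * norm f) * (norm (id_blinfun - B) * norm f)"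
          by (intro mult_mono norm_blinfun) auto
        also have "\<dots> \<le> (1 * norm f) * (1 * norm f)" using nB nB' by (intro mult_mono) auto
        finally show "(norm (S' (B f)))\<^sup>2 \<le> (norm f * 1)\<^sup>2" by (simp add: power2_eq_square)
      qed simp
    qed
    define P where "P = Blinfun (\<lambda>f. S' (B f))"
    have P: "P f = S' (B f)" for f unfolding P_def by (simp add: bounded_linear_Blinfun_apply[OF bl])
    have PB: "P (B f) = B (P f)" for f using SB[OF BD'(1)] by (simp add: P)
    have PM: "P (T (R f)) = T (R (P f))" for f using Rc[of P, OF PB] Tc[of P, OF PB] by simp
    define M where "M = T o\<^sub>L R"
    have M: "M f = T (R f)" for f by (simp add: M_def)
    have Msym: "inner (M f) g = inner f (M g)" for f g by (simp add: M Ts Rs RT)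
    have Mnn: "0 \<le> inner (M f) f" for f using TRnn[of f] by (simp add: M Ts Rs RT[symmetric])
    have MM: "M (M f) = B f - B (B f)" for f
      by (simp add: M RT TT RR blinfun.bilinear_simps)
    have MP: "M f = P f" for f
    proof -
      \<comment> \<open>M and P are commuting nonnegative roots of the same operator: (M + P)(M - P) = 0.\<close>
      define y where "y = M f - P f"
      have 0: "M y + P y = 0"
        using PM MM[of f] PP[of f] by (simp add: y_def blinfun.bilinear_simps M P)
      then have "inner (M y) y + inner (P y) y = 0" by (metis inner_add_left inner_zero_left)
      then have "inner (M y) y = 0" using Mnn[of y] Pnn[of y] by (simp add: P)
      then have "M y = 0" by (rule nonneg_symmetric_null_vector[OF Msym Mnn])
      moreover from this have "P y = 0" using 0 by simp
      moreover have "inner y y = inner f (M y) - inner f (P y)"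
        unfolding y_def by (subst (1) inner_diff_left) (simp add: Msym P Psym)
      ultimately show ?thesis by (simp add: y_def)
    qed
    \<comment> \<open>The equality of M and P says S' R R g = T R g, hence S' R = T on the range of
      R only. That range is dense, and closedness of \<open>S'\<close> extends the equation to every
      \<open>f\<close>.\<close>
    have ext: "R f \<in> DS' \<and> S' (R f) = T f" for f
    proof -
      obtain x where "\<And>n. x n \<in> DS" and x: "x \<longlonglongrightarrow> f"
        using dense closure_sequential[of f DS] by auto
      then have "\<forall>n. \<exists>g. x n = R g" unfolding DS_def by blast
      then obtain g where g: "\<And>n. x n = R (g n)" by metis
      have "S' (R (x n)) = T (x n)" for n using MP[of "g n"] by (simp add: g RR M P)
      moreover have "(\<lambda>n. T (x n)) \<longlonglongrightarrow> T f" by (intro tendsto_intros x)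
      ultimately have "(\<lambda>n. S' (R (x n))) \<longlonglongrightarrow> T f" by simp
      moreover have "(\<lambda>n. R (x n)) \<longlonglongrightarrow> R f" by (intro tendsto_intros x)
      moreover have "R (x n) \<in> DS'" for n by (simp add: g RR BD')
      ultimately show ?thesis using sa_closed_graph[OF sa', of "\<lambda>n. R (x n)"] by blast
    qed
    have eq: "u \<in> DS' \<and> S' u = S u" if "u \<in> DS" for u
      using that ext unfolding DS_def by (auto simp: SR)
    have "DS' \<subseteq> DS"
    proof
      fix v assume v: "v \<in> DS'"
      show "v \<in> DS"
      proof (rule sa_adjoint(1)[OF saS])
        show "inner (S u) v = inner u (S' v)" if "u \<in> DS" for u
          using sym'[of u v] eq[OF that] v by simp
      qed
    qed
    then show ?thesis using eq by blast
  qed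
  show ?thesis
  proof (rule that)
    show "nonneg_sqrt D L DS S" unfolding nonneg_sqrt_def using saS nnS domS sqS by blast
    show "\<forall>DS' S'. nonneg_sqrt D L DS' S' \<longrightarrow> DS' = DS \<and> (\<forall>u\<in>DS. S' u = S u)"
      unfolding nonneg_sqrt_def using uniq by blast
  qed (use com in blast)
qed

section \<open>The Hilbert space of square-summable functions\<close>

lemma sq_summable_product:
  fixes f g :: "'v \<Rightarrow> complex"
  assumes "(\<lambda>x. (cmod (f x))\<^sup>2) summable_on A" "(\<lambda>x. (cmod (g x))\<^sup>2) summable_on A"
  shows "(\<lambda>x. f x * cnj (g x)) summable_on A"
proof (rule abs_summable_summable, rule summable_on_comparison_test)
  show "(\<lambda>x. (cmod (f x))\<^sup>2 + (cmod (g x))\<^sup>2) summable_on A" by (rule summable_on_add[OF assms])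
  show "norm (f x * cnj (g x)) \<le> (cmod (f x))\<^sup>2 + (cmod (g x))\<^sup>2" for x
  proof -
    have "2 * (cmod (f x) * cmod (g x)) \<le> (cmod (f x))\<^sup>2 + (cmod (g x))\<^sup>2"
      using sum_squares_bound[of "cmod (f x)" "cmod (g x)"] by (simp add: mult.assoc)
    moreover have "0 \<le> cmod (f x) * cmod (g x)" by simp
    ultimately show ?thesis unfolding norm_mult complex_mod_cnj by linarith
  qed
qed simp

lemma sq_summable_add:
  fixes f g :: "'v \<Rightarrow> complex"
  assumes "(\<lambda>x. (cmod (f x))\<^sup>2) summable_on A" "(\<lambda>x. (cmod (g x))\<^sup>2) summable_on A"
  shows "(\<lambda>x. (cmod (f x + g x))\<^sup>2) summable_on A"
proof (rule summable_on_comparison_test)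
  show "(\<lambda>x. 2 * (cmod (f x))\<^sup>2 + 2 * (cmod (g x))\<^sup>2) summable_on A"
    by (intro summable_on_add summable_on_cmult_right assms)
  show "(cmod (f x + g x))\<^sup>2 \<le> 2 * (cmod (f x))\<^sup>2 + 2 * (cmod (g x))\<^sup>2" for x
  proof -
    have "(cmod (f x + g x))\<^sup>2 \<le> (cmod (f x) + cmod (g x))\<^sup>2" by (intro power_mono norm_triangle_ineq) simp
    also have "\<dots> \<le> 2 * (cmod (f x))\<^sup>2 + 2 * (cmod (g x))\<^sup>2"
      using sum_squares_bound[of "cmod (f x)" "cmod (g x)"] by (simp add: power2_sum)
    finally show ?thesis .
  qed
qed simp

lemma sq_summable_mult:
  fixes f :: "'v \<Rightarrow> complex"
  assumes "(\<lambda>x. (cmod (f x))\<^sup>2) summable_on A"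
  shows "(\<lambda>x. (cmod (a * f x))\<^sup>2) summable_on A"
  using summable_on_cmult_right[OF assms, of "(cmod a)\<^sup>2"] by (simp add: norm_mult power_mult_distrib)

text \<open>The weight is left out because a type cannot depend on \<open>m\<close>; multiplication
  by \<open>sqrt (m x)\<close> will carry the weighted space isometrically onto this one.\<close>

typedef 'v ell2 = "{f :: 'v \<Rightarrow> complex. (\<lambda>x. (cmod (f x))\<^sup>2) summable_on UNIV}"
  morphisms ell2_fun Abs_ell2
  by (rule exI[of _ "\<lambda>_. 0"]) simp

lemma ell2_fun_summable: "(\<lambda>x. (cmod (ell2_fun f x))\<^sup>2) summable_on UNIV"
  using ell2_fun[of f] by simp

lemma ell2_fun_Abs: "(\<lambda>x. (cmod (f x))\<^sup>2) summable_on UNIV \<Longrightarrow> ell2_fun (Abs_ell2 f) = f"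
  by (rule Abs_ell2_inverse) simp

lemma ell2_eqI: "(\<And>x. ell2_fun f x = ell2_fun g x) \<Longrightarrow> f = g"
  by (metis ell2_fun_inject ext)

instantiation ell2 :: (type) real_inner
begin

definition "zero_ell2 = Abs_ell2 (\<lambda>_. 0)"
definition "plus_ell2 f g = Abs_ell2 (\<lambda>x. ell2_fun f x + ell2_fun g x)"
definition "uminus_ell2 f = Abs_ell2 (\<lambda>x. (-1) * ell2_fun f x)"
definition minus_ell2 :: "'a ell2 \<Rightarrow> 'a ell2 \<Rightarrow> 'a ell2" where "minus_ell2 f g = f + (- g)"
definition "scaleR_ell2 r f = Abs_ell2 (\<lambda>x. complex_of_real r * ell2_fun f x)"
definition "inner_ell2 f g = (\<Sum>\<^sub>\<infinity>x. Re (ell2_fun f x * cnj (ell2_fun g x)))"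
definition norm_ell2 :: "'a ell2 \<Rightarrow> real" where "norm_ell2 f = sqrt (inner f f)"
definition sgn_ell2 :: "'a ell2 \<Rightarrow> 'a ell2" where "sgn_ell2 f = inverse (norm f) *\<^sub>R f"
definition dist_ell2 :: "'a ell2 \<Rightarrow> 'a ell2 \<Rightarrow> real" where "dist_ell2 f g = norm (f - g)"
definition [code del]: "uniformity_ell2 = (INF e\<in>{0<..}. principal {(f :: 'a ell2, g). dist f g < e})"
definition [code del]:
  "open_ell2 U = (\<forall>f\<in>U. eventually (\<lambda>(f', g). f' = f \<longrightarrow> g \<in> U) (uniformity :: ('a ell2 \<times> 'a ell2) filter))"

lemma ell2_fun_0: "ell2_fun 0 x = 0"
  unfolding zero_ell2_def by (simp add: ell2_fun_Abs)

lemma ell2_fun_add: "ell2_fun (f + g) x = ell2_fun f x + ell2_fun g x"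
  unfolding plus_ell2_def by (simp add: ell2_fun_Abs sq_summable_add ell2_fun_summable)

lemma ell2_fun_uminus: "ell2_fun (- f) x = - ell2_fun f x"
  unfolding uminus_ell2_def using ell2_fun_Abs[OF sq_summable_mult[OF ell2_fun_summable, of "-1" f]] by simp

lemma ell2_fun_diff: "ell2_fun (f - g) x = ell2_fun f x - ell2_fun g x"
  unfolding minus_ell2_def by (simp add: ell2_fun_add ell2_fun_uminus)

lemma ell2_fun_scaleR: "ell2_fun (r *\<^sub>R f) x = complex_of_real r * ell2_fun f x"
  unfolding scaleR_ell2_def by (simp add: ell2_fun_Abs[OF sq_summable_mult[OF ell2_fun_summable]])

lemma ell2_inner_self: "inner f f = (\<Sum>\<^sub>\<infinity>x. (cmod (ell2_fun f x))\<^sup>2)"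
  unfolding inner_ell2_def by (simp add: complex_norm_square[symmetric] del: of_real_power)

instance
proof
  fix f g h :: "'a ell2" and a b :: real
  note app = ell2_fun_0 ell2_fun_add ell2_fun_uminus ell2_fun_diff ell2_fun_scaleR
  have sm: "(\<lambda>x. Re (ell2_fun f x * cnj (ell2_fun g x))) summable_on UNIV" for f g :: "'a ell2"
    by (intro summable_on_Re sq_summable_product ell2_fun_summable)
  show "f + g + h = f + (g + h)" "f + g = g + f" "0 + f = f" "- f + f = 0" "f - g = f + - g"
    "a *\<^sub>R (f + g) = a *\<^sub>R f + a *\<^sub>R g" "(a + b) *\<^sub>R f = a *\<^sub>R f + b *\<^sub>R f"
    "a *\<^sub>R b *\<^sub>R f = (a * b) *\<^sub>R f" "1 *\<^sub>R f = f"
    by (rule ell2_eqI; simp add: app algebra_simps)+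
  show "inner f g = inner g f" unfolding inner_ell2_def by (intro infsum_cong) (simp add: algebra_simps)
  show "inner (f + g) h = inner f h + inner g h"
    unfolding inner_ell2_def infsum_add[OF sm sm, symmetric] by (intro infsum_cong) (simp add: app algebra_simps)
  show "inner (a *\<^sub>R f) g = a * inner f g"
    unfolding inner_ell2_def infsum_cmult_right'[symmetric] by (intro infsum_cong) (simp add: app algebra_simps)
  show "0 \<le> inner f f" unfolding ell2_inner_self by (rule infsum_nonneg) simp
  show "inner f f = 0 \<longleftrightarrow> f = 0"
  proof
    assume "inner f f = 0"
    then have "(cmod (ell2_fun f x))\<^sup>2 = 0" for x
      using nonneg_infsum_le_0D[of "\<lambda>x. (cmod (ell2_fun f x))\<^sup>2" UNIV x] ell2_fun_summable[of f]
      unfolding ell2_inner_self by simp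
    then show "f = 0" by (intro ell2_eqI) (simp add: app)
  qed (simp add: ell2_inner_self app)
qed (simp_all add: norm_ell2_def sgn_ell2_def dist_ell2_def uniformity_ell2_def open_ell2_def)

end

lemma ell2_norm_sq: "(norm f)\<^sup>2 = (\<Sum>\<^sub>\<infinity>x. (cmod (ell2_fun f x))\<^sup>2)"
  unfolding power2_norm_eq_inner ell2_inner_self ..

lemma ell2_finite_sum_le: "finite F \<Longrightarrow> (\<Sum>x\<in>F. (cmod (ell2_fun f x))\<^sup>2) \<le> (norm f)\<^sup>2"
  unfolding ell2_norm_sq by (intro finite_sum_le_infsum ell2_fun_summable) auto

lemma ell2_coord_le: "cmod (ell2_fun f x) \<le> norm f"
  by (rule power2_le_imp_le) (use ell2_finite_sum_le[of "{x}" f] in auto)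

lemma bounded_linear_ell2_coord: "bounded_linear (\<lambda>f. ell2_fun f x)"
  by (rule bounded_linear_intro[where K = 1])
    (auto simp: ell2_fun_add ell2_fun_scaleR scaleR_conv_of_real ell2_coord_le)

text \<open>Coordinates are bounded functionals, so a Cauchy sequence has a pointwise limit. The
  Cauchy bound passes to this limit in sums over finite sets, uniformly in the set, which gives both
  its square-summability and the norm convergence.\<close>

instance ell2 :: (type) banach
proof
  fix X :: "nat \<Rightarrow> 'a ell2" assume C: "Cauchy X"
  have "Cauchy (\<lambda>n. ell2_fun (X n) x)" for x
    by (rule bounded_linear.Cauchy[OF bounded_linear_ell2_coord C])
  then have "\<forall>x. \<exists>l. (\<lambda>n. ell2_fun (X n) x) \<longlonglongrightarrow> l" using Cauchy_convergent convergent_def by blast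
  then obtain g where g: "\<And>x. (\<lambda>n. ell2_fun (X n) x) \<longlonglongrightarrow> g x" by metis
  have fin: "(\<Sum>x\<in>F. (cmod (ell2_fun (X n) x - g x))\<^sup>2) \<le> e\<^sup>2"
    if F: "finite F" and le: "\<And>k. k \<ge> N \<Longrightarrow> norm (X n - X k) \<le> e" for F n N e
  proof (rule LIMSEQ_le_const2)
    show "(\<lambda>k. \<Sum>x\<in>F. (cmod (ell2_fun (X n) x - ell2_fun (X k) x))\<^sup>2) \<longlonglongrightarrow>
        (\<Sum>x\<in>F. (cmod (ell2_fun (X n) x - g x))\<^sup>2)" by (intro tendsto_intros g)
    have "(\<Sum>x\<in>F. (cmod (ell2_fun (X n) x - ell2_fun (X k) x))\<^sup>2) \<le> e\<^sup>2" if "k \<ge> N" for k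
    proof -
      have "(\<Sum>x\<in>F. (cmod (ell2_fun (X n) x - ell2_fun (X k) x))\<^sup>2) \<le> (norm (X n - X k))\<^sup>2"
        using ell2_finite_sum_le[OF F, of "X n - X k"] by (simp add: ell2_fun_diff)
      also have "\<dots> \<le> e\<^sup>2" using le[OF that] by (rule power_mono) simp
      finally show ?thesis .
    qed
    then show "\<exists>N. \<forall>k\<ge>N. (\<Sum>x\<in>F. (cmod (ell2_fun (X n) x - ell2_fun (X k) x))\<^sup>2) \<le> e\<^sup>2" by blast
  qed
  have sm: "(\<lambda>x. (cmod (ell2_fun (X n) x - g x))\<^sup>2) summable_on UNIV"
    if "\<And>k. k \<ge> N \<Longrightarrow> norm (X n - X k) \<le> e" for n N e
    by (rule nonneg_bdd_above_summable_on) (use fin[OF _ that] in \<open>auto intro!: bdd_aboveI2[where M = "e\<^sup>2"]\<close>)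
  obtain N1 where N1: "\<And>j k. j \<ge> N1 \<Longrightarrow> k \<ge> N1 \<Longrightarrow> norm (X j - X k) < 1"
    using C unfolding Cauchy_def dist_norm by (metis zero_less_one)
  have "(\<lambda>x. (cmod (ell2_fun (X N1) x - g x))\<^sup>2) summable_on UNIV"
    using sm[of N1 N1 1] N1 less_imp_le by blast
  from sq_summable_add[OF ell2_fun_summable[of "X N1"] sq_summable_mult[OF this, of "-1"]]
  have gs: "(\<lambda>x. (cmod (g x))\<^sup>2) summable_on UNIV" by simp
  define G where "G = Abs_ell2 g"
  have G: "ell2_fun G = g" unfolding G_def by (rule ell2_fun_Abs[OF gs])
  have "X \<longlonglongrightarrow> G"
  proof (rule metric_LIMSEQ_I)
    fix e :: real assume e: "e > 0"
    then obtain N where N: "\<And>j k. j \<ge> N \<Longrightarrow> k \<ge> N \<Longrightarrow> norm (X j - X k) < e / 2"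
      using C unfolding Cauchy_def dist_norm by (metis half_gt_zero)
    have "dist (X n) G < e" if n: "n \<ge> N" for n
    proof -
      have le: "norm (X n - X k) \<le> e / 2" if "k \<ge> N" for k using N[OF n that] by simp
      have "(norm (X n - G))\<^sup>2 \<le> (e / 2)\<^sup>2"
        unfolding ell2_norm_sq ell2_fun_diff G by (rule infsum_le_finite_sums[OF sm[OF le] fin[OF _ le]])
      then have "norm (X n - G) \<le> e / 2" by (rule power2_le_imp_le) (use e in simp)
      then show ?thesis using e by (simp add: dist_norm)
    qed
    then show "\<exists>N. \<forall>n\<ge>N. dist (X n) G < e" by blast
  qed
  then show "convergent X" unfolding convergent_def by blast
qed

section \<open>Transfer to the weighted space\<close>

definition to_ell2 :: "('v \<Rightarrow> real) \<Rightarrow> 'v fn \<Rightarrow> 'v ell2" where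
  "to_ell2 m u = Abs_ell2 (\<lambda>x. u x * complex_of_real (sqrt (m x)))"

definition of_ell2 :: "('v \<Rightarrow> real) \<Rightarrow> 'v ell2 \<Rightarrow> 'v fn" where
  "of_ell2 m f = (\<lambda>x. ell2_fun f x / complex_of_real (sqrt (m x)))"

definition ell2_i :: "'v ell2 \<Rightarrow>\<^sub>L 'v ell2" where
  "ell2_i = Blinfun (\<lambda>f. Abs_ell2 (\<lambda>x. \<i> * ell2_fun f x))"

lemma ell2_fun_i: "ell2_fun (ell2_i f) x = \<i> * ell2_fun f x"
proof -
  have app: "ell2_fun (Abs_ell2 (\<lambda>x. \<i> * ell2_fun f x)) = (\<lambda>x. \<i> * ell2_fun f x)" for f :: "'a ell2"
    by (rule ell2_fun_Abs[OF sq_summable_mult[OF ell2_fun_summable]])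
  have "bounded_linear (\<lambda>f :: 'a ell2. Abs_ell2 (\<lambda>x. \<i> * ell2_fun f x))"
  proof (rule bounded_linear_intro[where K = 1])
    fix f g :: "'a ell2" and r :: real
    show "Abs_ell2 (\<lambda>x. \<i> * ell2_fun (f + g) x) = Abs_ell2 (\<lambda>x. \<i> * ell2_fun f x) + Abs_ell2 (\<lambda>x. \<i> * ell2_fun g x)"
      by (rule ell2_eqI) (simp only: ell2_fun_add[of "Abs_ell2 F" for F] app, simp add: ell2_fun_add algebra_simps)
    show "Abs_ell2 (\<lambda>x. \<i> * ell2_fun (r *\<^sub>R f) x) = r *\<^sub>R Abs_ell2 (\<lambda>x. \<i> * ell2_fun f x)"
      by (rule ell2_eqI) (simp only: ell2_fun_scaleR[of _ "Abs_ell2 F" for F] app, simp add: ell2_fun_scaleR)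
    show "norm (Abs_ell2 (\<lambda>x. \<i> * ell2_fun f x)) \<le> norm f * 1"
      by (rule power2_le_imp_le) (simp_all add: ell2_norm_sq app norm_mult)
  qed
  then show ?thesis unfolding ell2_i_def by (simp add: bounded_linear_Blinfun_apply app)
qed

context
  fixes m :: "'v \<Rightarrow> real"
  assumes mpos: "\<forall>x. 0 < m x"
begin

lemma sqrt_m_sq: "(sqrt (m x))\<^sup>2 = m x"
  using mpos less_imp_le by (intro real_sqrt_pow2) blast

lemma sqrt_m: "complex_of_real (sqrt (m x)) \<noteq> 0" "complex_of_real (sqrt (m x)) * complex_of_real (sqrt (m x)) = of_real (m x)"
  using mpos[rule_format, of x] less_imp_le by (auto simp flip: of_real_mult)

lemma l2_iff: "u \<in> l2 m \<longleftrightarrow> (\<lambda>x. (cmod (u x * complex_of_real (sqrt (m x))))\<^sup>2) summable_on UNIV"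
  by (simp add: l2_def norm_mult power_mult_distrib sqrt_m_sq)

lemma ell2_fun_to: "u \<in> l2 m \<Longrightarrow> ell2_fun (to_ell2 m u) x = u x * complex_of_real (sqrt (m x))"
  unfolding to_ell2_def l2_iff by (simp add: ell2_fun_Abs)

lemma of_to_ell2: "u \<in> l2 m \<Longrightarrow> of_ell2 m (to_ell2 m u) = u"
  by (rule ext) (use sqrt_m in \<open>simp add: of_ell2_def ell2_fun_to\<close>)

lemma of_ell2_l2: "of_ell2 m f \<in> l2 m"
  unfolding l2_iff using sqrt_m by (simp add: of_ell2_def ell2_fun_summable)

lemma to_of_ell2: "to_ell2 m (of_ell2 m f) = f"
  by (rule ell2_eqI) (use sqrt_m in \<open>simp add: ell2_fun_to of_ell2_l2\<close>, simp add: of_ell2_def)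

lemma l2_lin: "u \<in> l2 m \<Longrightarrow> v \<in> l2 m \<Longrightarrow> (\<lambda>x. u x + a * v x) \<in> l2 m"
proof -
  assume "u \<in> l2 m" "v \<in> l2 m"
  then have "(\<lambda>x. (cmod (u x * complex_of_real (sqrt (m x)) + a * (v x * complex_of_real (sqrt (m x)))))\<^sup>2) summable_on UNIV"
    unfolding l2_iff by (intro sq_summable_add sq_summable_mult)
  then show ?thesis unfolding l2_iff by (simp add: algebra_simps)
qed

lemma l2_zero: "(\<lambda>x. 0) \<in> l2 m" by (simp add: l2_def)

lemma l2_scale: "v \<in> l2 m \<Longrightarrow> (\<lambda>x. a * v x) \<in> l2 m"
  using l2_lin[OF l2_zero] by simp

lemma l2_diff: "u \<in> l2 m \<Longrightarrow> v \<in> l2 m \<Longrightarrow> (\<lambda>x. u x - v x) \<in> l2 m"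
  using l2_lin[of u v "-1"] by simp

lemma to_ell2_lin:
  "u \<in> l2 m \<Longrightarrow> v \<in> l2 m \<Longrightarrow> to_ell2 m (\<lambda>x. u x + complex_of_real a * v x) = to_ell2 m u + a *\<^sub>R to_ell2 m v"
  by (rule ell2_eqI) (simp add: ell2_fun_to l2_lin ell2_fun_add ell2_fun_scaleR algebra_simps)

lemma to_ell2_diff: "u \<in> l2 m \<Longrightarrow> v \<in> l2 m \<Longrightarrow> to_ell2 m (\<lambda>x. u x - v x) = to_ell2 m u - to_ell2 m v"
  using to_ell2_lin[of u v "-1"] by simp

lemma to_ell2_i: "u \<in> l2 m \<Longrightarrow> to_ell2 m (\<lambda>x. \<i> * u x) = ell2_i (to_ell2 m u)"
  by (rule ell2_eqI) (simp add: ell2_fun_to l2_scale ell2_fun_i algebra_simps)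

lemma of_ell2_lin: "of_ell2 m (f + Re a *\<^sub>R g + Im a *\<^sub>R ell2_i g) = (\<lambda>x. of_ell2 m f x + a * of_ell2 m g x)"
proof
  fix x
  have "complex_of_real (Re a) + complex_of_real (Im a) * \<i> = a" by (simp add: complex_eq_iff)
  then have "ell2_fun (f + Re a *\<^sub>R g + Im a *\<^sub>R ell2_i g) x = ell2_fun f x + a * ell2_fun g x"
    by (simp add: ell2_fun_add ell2_fun_scaleR ell2_fun_i) (metis distrib_right mult.assoc)
  then show "of_ell2 m (f + Re a *\<^sub>R g + Im a *\<^sub>R ell2_i g) x = of_ell2 m f x + a * of_ell2 m g x"
    by (simp add: of_ell2_def add_divide_distrib)
qed

lemma l2_product_summable:
  assumes "u \<in> l2 m" "v \<in> l2 m"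
  shows "(\<lambda>x. u x * cnj (v x) * complex_of_real (m x)) summable_on UNIV"
  using sq_summable_product[OF assms[unfolded l2_iff]]
  by (simp add: mult.assoc mult.left_commute[of "complex_of_real (sqrt _)"] sqrt_m del: of_real_mult)

lemma l2inner_lin_left:
  assumes "u \<in> l2 m" "v \<in> l2 m" "w \<in> l2 m"
  shows "l2inner m (\<lambda>x. u x + a * v x) w = l2inner m u w + a * l2inner m v w"
  unfolding l2inner_def infsum_cmult_right'[symmetric]
    infsum_add[OF l2_product_summable[OF assms(1,3)] summable_on_cmult_right[OF l2_product_summable[OF assms(2,3)]], symmetric]
  by (intro infsum_cong) (simp add: algebra_simps)

lemma l2inner_cnj: "l2inner m v u = cnj (l2inner m u v)"
  unfolding l2inner_def infsum_cnj[symmetric] by (intro infsum_cong) simp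

lemma l2inner_scale_left: "v \<in> l2 m \<Longrightarrow> w \<in> l2 m \<Longrightarrow> l2inner m (\<lambda>x. a * v x) w = a * l2inner m v w"
  unfolding l2inner_def infsum_cmult_right'[symmetric] by (intro infsum_cong) simp

lemma Re_l2inner: "u \<in> l2 m \<Longrightarrow> v \<in> l2 m \<Longrightarrow> Re (l2inner m u v) = inner (to_ell2 m u) (to_ell2 m v)"
proof -
  assume uv: "u \<in> l2 m" "v \<in> l2 m"
  have "u x * cnj (v x) * complex_of_real (m x) =
      ell2_fun (to_ell2 m u) x * cnj (ell2_fun (to_ell2 m v) x)" for x
    unfolding sqrt_m(2)[of x, symmetric] using uv by (simp add: ell2_fun_to del: of_real_mult)
  then show ?thesis
    unfolding l2inner_def inner_ell2_def by (subst infsum_Re[symmetric]) (simp_all add: l2_product_summable[OF uv] flip: \<open>\<And>x. u x * _ x * _ x = _ x\<close>)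
qed

text \<open>From \<open>Re (\<i> * z) = - Im z\<close>: the real inner product together with
  \<open>ell2_i\<close> still determines the complex one.\<close>

lemma Im_l2inner: "u \<in> l2 m \<Longrightarrow> v \<in> l2 m \<Longrightarrow> Im (l2inner m u v) = - inner (ell2_i (to_ell2 m u)) (to_ell2 m v)"
  using Re_l2inner[OF l2_scale, of u v \<i>] l2inner_scale_left[of u v \<i>] to_ell2_i[of u] by simp

lemma l2norm_to: "u \<in> l2 m \<Longrightarrow> l2norm m u = norm (to_ell2 m u)"
proof -
  assume u: "u \<in> l2 m"
  have "(cmod (u x))\<^sup>2 * m x = (cmod (ell2_fun (to_ell2 m u) x))\<^sup>2" for x
    using u by (simp add: ell2_fun_to norm_mult power_mult_distrib sqrt_m_sq)
  then have "l2norm m u = sqrt ((norm (to_ell2 m u))\<^sup>2)" unfolding l2norm_def ell2_norm_sq by simp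
  then show ?thesis by simp
qed

lemma l2_subspaceD:
  assumes "l2_subspace m D"
  shows "\<And>u. u \<in> D \<Longrightarrow> u \<in> l2 m" "(\<lambda>x. 0) \<in> D"
    "\<And>u v a. u \<in> D \<Longrightarrow> v \<in> D \<Longrightarrow> (\<lambda>x. u x + a * v x) \<in> D"
    "\<And>u a. u \<in> D \<Longrightarrow> (\<lambda>x. a * u x) \<in> D"
    "\<And>u v. u \<in> D \<Longrightarrow> v \<in> D \<Longrightarrow> (\<lambda>x. u x - v x) \<in> D"
proof -
  show "\<And>u. u \<in> D \<Longrightarrow> u \<in> l2 m" "(\<lambda>x. 0) \<in> D"
    and *: "\<And>u v a. u \<in> D \<Longrightarrow> v \<in> D \<Longrightarrow> (\<lambda>x. u x + a * v x) \<in> D"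
    using assms unfolding l2_subspace_def by auto
  show "\<And>u a. u \<in> D \<Longrightarrow> (\<lambda>x. a * u x) \<in> D" using *[OF \<open>(\<lambda>x. 0) \<in> D\<close>] by simp
  show "\<And>u v. u \<in> D \<Longrightarrow> v \<in> D \<Longrightarrow> (\<lambda>x. u x - v x) \<in> D" using *[of _ _ "-1"] by simp
qed

text \<open>The map to_ell2 is unitary, but the target is treated as a real Hilbert space with inner
  product the real part; complex linearity is recovered as commutation with ell2_i.\<close>

definition transfer_op :: "('v fn \<Rightarrow> 'v fn) \<Rightarrow> 'v ell2 \<Rightarrow> 'v ell2" where
  "transfer_op L f = to_ell2 m (L (of_ell2 m f))"

lemma selfadjoint_real:
  assumes "selfadjoint m D L"
  shows "real_selfadjoint (to_ell2 m ` D) (transfer_op L)"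
    "\<And>u. u \<in> D \<Longrightarrow> transfer_op L (to_ell2 m u) = to_ell2 m (L u)"
    "\<And>f. f \<in> to_ell2 m ` D \<Longrightarrow> ell2_i f \<in> to_ell2 m ` D"
    "\<And>f. f \<in> to_ell2 m ` D \<Longrightarrow> transfer_op L (ell2_i f) = ell2_i (transfer_op L f)"
proof -
  have lin: "linear_op m D L" and dense: "l2_dense m D" and adj: "adjoint_dom m D L = D"
    and sym: "\<And>u v. u \<in> D \<Longrightarrow> v \<in> D \<Longrightarrow> l2inner m (L u) v = l2inner m u (L v)"
    using assms unfolding selfadjoint_def by blast+
  have sub: "l2_subspace m D" and Ll2: "\<And>u. u \<in> D \<Longrightarrow> L u \<in> l2 m"
    and Llin: "\<And>u v a. u \<in> D \<Longrightarrow> v \<in> D \<Longrightarrow> L (\<lambda>x. u x + a * v x) = (\<lambda>x. L u x + a * L v x)"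
    using lin unfolding linear_op_def by blast+
  note D = l2_subspaceD[OF sub]
  have L0: "L (\<lambda>x. 0) = (\<lambda>x. 0)" using Llin[OF D(2) D(2), of 1] by (simp add: fun_eq_iff)
  have Lsc: "L (\<lambda>x. a * u x) = (\<lambda>x. a * L u x)" if "u \<in> D" for u a
    using Llin[OF D(2) that, of a] by (simp add: L0)
  show app: "\<And>u. u \<in> D \<Longrightarrow> transfer_op L (to_ell2 m u) = to_ell2 m (L u)"
    using D(1) by (simp add: transfer_op_def of_to_ell2)
  show "\<And>f. f \<in> to_ell2 m ` D \<Longrightarrow> ell2_i f \<in> to_ell2 m ` D"
    using D by (auto simp: to_ell2_i[symmetric])
  show "\<And>f. f \<in> to_ell2 m ` D \<Longrightarrow> transfer_op L (ell2_i f) = ell2_i (transfer_op L f)"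
    using D Ll2 by (auto simp: to_ell2_i[symmetric] app Lsc)
  have U0: "to_ell2 m (\<lambda>x. 0) = 0" by (rule ell2_eqI) (simp add: ell2_fun_to l2_zero ell2_fun_0)
  have Ulin: "to_ell2 m u + a *\<^sub>R to_ell2 m v = to_ell2 m (\<lambda>x. u x + complex_of_real a * v x)" if "u \<in> D" "v \<in> D" for u v a
    using to_ell2_lin D(1) that by simp
  show "real_selfadjoint (to_ell2 m ` D) (transfer_op L)"
    unfolding real_selfadjoint_def
  proof (intro conjI ballI allI impI)
    show "subspace (to_ell2 m ` D)"
    proof (rule subspaceI)
      show "0 \<in> to_ell2 m ` D" using U0 D(2) by (metis image_eqI)
      show "p + q \<in> to_ell2 m ` D" if "p \<in> to_ell2 m ` D" "q \<in> to_ell2 m ` D" for p q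
        using that Ulin[of _ _ 1] D(3)[of _ _ 1] by auto
      show "a *\<^sub>R p \<in> to_ell2 m ` D" if "p \<in> to_ell2 m ` D" for a p
        using that Ulin[OF D(2), of _ a] D(4)[of _ "of_real a"] by (auto simp: U0)
    qed
    show "closure (to_ell2 m ` D) = UNIV"
    proof (intro set_eqI iffI UNIV_I)
      fix f
      show "f \<in> closure (to_ell2 m ` D)"
        unfolding closure_approachable
      proof (intro allI impI)
        fix e :: real assume "e > 0"
        then obtain v where v: "v \<in> D" "l2norm m (\<lambda>x. of_ell2 m f x - v x) < e"
          using dense of_ell2_l2 unfolding l2_dense_def by blast
        then have "norm (f - to_ell2 m v) < e"
          by (simp add: l2norm_to l2_diff of_ell2_l2 D(1) to_ell2_diff to_of_ell2)
        then show "\<exists>y\<in>to_ell2 m ` D. dist y f < e"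
          using v by (auto simp: dist_norm norm_minus_commute intro!: bexI[of _ v])
      qed
    qed
  next
    fix f g a assume "f \<in> to_ell2 m ` D" "g \<in> to_ell2 m ` D"
    then show "transfer_op L (f + a *\<^sub>R g) = transfer_op L f + a *\<^sub>R transfer_op L g"
      using D(3) Ll2 by (auto simp: Ulin app Llin to_ell2_lin)
  next
    fix f g assume "f \<in> to_ell2 m ` D" "g \<in> to_ell2 m ` D"
    then obtain u v where uv: "u \<in> D" "v \<in> D" "f = to_ell2 m u" "g = to_ell2 m v" by blast
    then show "inner (transfer_op L f) g = inner f (transfer_op L g)"
      using arg_cong[OF sym[OF uv(1,2)], of Re] D(1) Ll2 by (simp add: app Re_l2inner)
  next
    fix f g assume H: "\<forall>p\<in>to_ell2 m ` D. inner (transfer_op L p) f = inner p g"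
    let ?v = "of_ell2 m f" and ?w = "of_ell2 m g"
    have Re: "Re (l2inner m (L u) ?v) = Re (l2inner m u ?w)" if "u \<in> D" for u
      using H that D(1) Ll2 by (simp add: Re_l2inner of_ell2_l2 to_of_ell2 app)
    \<comment> \<open>Only real parts are known to agree. The identity is used for \<open>u\<close>
      and for i times \<open>u\<close>, which is again in \<open>D\<close>, to obtain the imaginary
      parts as well.\<close>
    have "l2inner m (L u) ?v = l2inner m u ?w" if u: "u \<in> D" for u
      using Re[OF u] Re[OF D(4)[OF u, of \<i>]] u D(1) Ll2
      by (simp add: complex_eq_iff Lsc l2inner_scale_left of_ell2_l2)
    then have "?v \<in> adjoint_dom m D L" unfolding adjoint_dom_def using of_ell2_l2 by blast
    then show "f \<in> to_ell2 m ` D" using adj to_of_ell2 by (metis image_eqI)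
  qed
qed

lemma nonneg_op_real:
  assumes "selfadjoint m D L" "nonneg_op m D L"
  shows "nonneg_on (to_ell2 m ` D) (transfer_op L)"
proof -
  have "\<And>u. u \<in> D \<Longrightarrow> u \<in> l2 m" "\<And>u. u \<in> D \<Longrightarrow> L u \<in> l2 m"
    using assms unfolding selfadjoint_def linear_op_def l2_subspace_def by blast+
  then show ?thesis using assms(2) unfolding nonneg_on_def nonneg_op_def
    by (auto simp: selfadjoint_real(2)[OF assms(1)] Re_l2inner)
qed

text \<open>Commutation with \<open>ell2_i\<close> makes the domain a complex subspace and the
  operator complex linear, and it supplies the imaginary part of the symmetry relation.
  \<open>S'\<close> is prescribed only on the domain, so that it can be given any values
  elsewhere.\<close>

lemma real_selfadjoint_back:
  assumes sa: "real_selfadjoint DS S" and i: "\<And>f. f \<in> DS \<Longrightarrow> ell2_i f \<in> DS \<and> S (ell2_i f) = ell2_i (S f)"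
    and app: "\<And>f. f \<in> DS \<Longrightarrow> S' (of_ell2 m f) = of_ell2 m (S f)"
  shows "selfadjoint m (of_ell2 m ` DS) S'"
proof -
  note sub = sa_sub[OF sa]
  have cl: "f + Re a *\<^sub>R g + Im a *\<^sub>R ell2_i g \<in> DS \<and>
      S (f + Re a *\<^sub>R g + Im a *\<^sub>R ell2_i g) = S f + Re a *\<^sub>R S g + Im a *\<^sub>R ell2_i (S g)"
    if "f \<in> DS" "g \<in> DS" for f g a
    using that i[of g] sub by (simp add: subspace_add subspace_scale sa_add[OF sa] sa_scale[OF sa])
  have 0: "of_ell2 m 0 = (\<lambda>x. 0)" by (simp add: of_ell2_def ell2_fun_0)
  have lin: "linear_op m (of_ell2 m ` DS) S'"
    unfolding linear_op_def l2_subspace_def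
  proof (intro conjI ballI allI)
    show "of_ell2 m ` DS \<subseteq> l2 m" using of_ell2_l2 by blast
    show "(\<lambda>x. 0) \<in> of_ell2 m ` DS" using 0 sa_0(1)[OF sa] by (metis image_eqI)
    show "S' u \<in> l2 m" if "u \<in> of_ell2 m ` DS" for u using that of_ell2_l2 by (auto simp: app)
  next
    fix u v a assume "u \<in> of_ell2 m ` DS" "v \<in> of_ell2 m ` DS"
    then obtain f g where fg: "f \<in> DS" "g \<in> DS" "u = of_ell2 m f" "v = of_ell2 m g" by blast
    have eq: "(\<lambda>x. u x + a * v x) = of_ell2 m (f + Re a *\<^sub>R g + Im a *\<^sub>R ell2_i g)"
      unfolding fg of_ell2_lin ..
    show "(\<lambda>x. u x + a * v x) \<in> of_ell2 m ` DS" using eq cl[OF fg(1,2), of a] by blast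
    show "S' (\<lambda>x. u x + a * v x) = (\<lambda>x. S' u x + a * S' v x)"
    proof -
      have "S' (\<lambda>x. u x + a * v x) = of_ell2 m (S f + Re a *\<^sub>R S g + Im a *\<^sub>R ell2_i (S g))"
        unfolding eq using app cl[OF fg(1,2), of a] by metis
      then show ?thesis by (simp add: of_ell2_lin app fg)
    qed
  qed
  have dense: "l2_dense m (of_ell2 m ` DS)"
    unfolding l2_dense_def
  proof (intro ballI allI impI)
    fix u and e :: real assume u: "u \<in> l2 m" and e: "e > 0"
    have "to_ell2 m u \<in> closure DS" using sa_dense[OF sa] by simp
    then obtain f where f: "f \<in> DS" "dist f (to_ell2 m u) < e"
      using e unfolding closure_approachable by blast
    then have "l2norm m (\<lambda>x. u x - of_ell2 m f x) < e"
      using u by (simp add: l2norm_to l2_diff of_ell2_l2 to_ell2_diff to_of_ell2 dist_norm norm_minus_commute)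
    then show "\<exists>v\<in>of_ell2 m ` DS. l2norm m (\<lambda>x. u x - v x) < e" using f by blast
  qed
  have sym: "l2inner m (S' u) v = l2inner m u (S' v)" if uv: "u \<in> of_ell2 m ` DS" "v \<in> of_ell2 m ` DS" for u v
  proof -
    obtain f g where fg: "f \<in> DS" "g \<in> DS" "u = of_ell2 m f" "v = of_ell2 m g" using uv by blast
    have "inner (S f) g = inner f (S g)" "inner (ell2_i (S f)) g = inner (ell2_i f) (S g)"
      using sa_sym[OF sa] fg i[of f] by metis+
    then show ?thesis using fg
      by (simp add: complex_eq_iff Re_l2inner Im_l2inner app of_ell2_l2 to_of_ell2)
  qed
  have "adjoint_dom m (of_ell2 m ` DS) S' = of_ell2 m ` DS"
  proof (intro set_eqI iffI)
    fix v assume "v \<in> adjoint_dom m (of_ell2 m ` DS) S'"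
    then obtain w where w: "v \<in> l2 m" "w \<in> l2 m"
      "\<And>u. u \<in> of_ell2 m ` DS \<Longrightarrow> l2inner m (S' u) v = l2inner m u w" unfolding adjoint_dom_def by blast
    have "inner (S f) (to_ell2 m v) = inner f (to_ell2 m w)" if "f \<in> DS" for f
      using arg_cong[OF w(3)[of "of_ell2 m f"], of Re] that w(1,2)
      by (simp add: app Re_l2inner of_ell2_l2 to_of_ell2)
    then have "to_ell2 m v \<in> DS" by (rule sa_max[OF sa])
    then show "v \<in> of_ell2 m ` DS" using of_to_ell2[OF w(1)] by (metis image_eqI)
  next
    fix v assume v: "v \<in> of_ell2 m ` DS"
    then have "v \<in> l2 m" "S' v \<in> l2 m" using of_ell2_l2 by (auto simp: app)
    then show "v \<in> adjoint_dom m (of_ell2 m ` DS) S'" unfolding adjoint_dom_def using sym v by blast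
  qed
  then show ?thesis unfolding selfadjoint_def using lin dense sym by blast
qed

text \<open>\<open>op_sqrt\<close> is a definite description, so nothing about it can be used before
  existence and uniqueness are settled. Both are obtained on \<open>ell2\<close> and carried
  back.\<close>

lemma op_sqrt_spec:
  assumes sa: "selfadjoint m D L" and nn: "nonneg_op m D L"
  defines "DS \<equiv> fst (op_sqrt m D L)" and "S \<equiv> snd (op_sqrt m D L)"
  shows "selfadjoint m DS S" "nonneg_op m DS S" "D = {u \<in> DS. S u \<in> DS}" "\<And>u. u \<in> D \<Longrightarrow> S (S u) = L u"
proof -
  let ?P = "\<lambda>(DS, S). selfadjoint m DS S \<and> nonneg_op m DS S \<and> (\<forall>u. u \<notin> DS \<longrightarrow> S u = (\<lambda>x. 0)) \<and>
      D = {u \<in> DS. S u \<in> DS} \<and> (\<forall>u\<in>D. S (S u) = L u)"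
  note real = selfadjoint_real[OF sa]
  have Dl2: "\<And>u. u \<in> D \<Longrightarrow> u \<in> l2 m" "\<And>u. u \<in> D \<Longrightarrow> L u \<in> l2 m"
    using sa unfolding selfadjoint_def linear_op_def l2_subspace_def by blast+
  obtain E R where ER: "nonneg_sqrt (to_ell2 m ` D) (transfer_op L) E R"
    and com: "\<forall>J :: 'v ell2 \<Rightarrow>\<^sub>L 'v ell2.
        (\<forall>u\<in>to_ell2 m ` D. J u \<in> to_ell2 m ` D \<and> transfer_op L (J u) = J (transfer_op L u)) \<longrightarrow>
        (\<forall>u\<in>E. J u \<in> E \<and> R (J u) = J (R u))"
    and uniq: "\<forall>DS' S'. nonneg_sqrt (to_ell2 m ` D) (transfer_op L) DS' S' \<longrightarrow> DS' = E \<and> (\<forall>u\<in>E. S' u = R u)"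
    using nonneg_sqrt_exists[OF real(1) nonneg_op_real[OF sa nn]] by blast
  then have E: "real_selfadjoint E R" "nonneg_on E R" "to_ell2 m ` D = {u \<in> E. R u \<in> E}"
    "\<And>u. u \<in> to_ell2 m ` D \<Longrightarrow> R (R u) = transfer_op L u"
    unfolding nonneg_sqrt_def by blast+
  have i: "\<And>f. f \<in> E \<Longrightarrow> ell2_i f \<in> E \<and> R (ell2_i f) = ell2_i (R f)"
    using com real(3,4) by blast
  have img: "of_ell2 m ` to_ell2 m ` F = F" if "\<And>u. u \<in> F \<Longrightarrow> u \<in> l2 m" for F
    using image_cong[of F F "\<lambda>u. of_ell2 m (to_ell2 m u)" "\<lambda>u. u"] that of_to_ell2 by (simp add: image_image)
  define E' where "E' = of_ell2 m ` E"
  \<comment> \<open>The value 0 outside \<open>E'\<close> is the normalisation in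
    \<open>op_sqrt\<close>. It turns uniqueness of the values on the domain into uniqueness of the
    pair.\<close>
  define R' where "R' u = (if u \<in> E' then of_ell2 m (R (to_ell2 m u)) else (\<lambda>x. 0))" for u
  have app: "R' (of_ell2 m f) = of_ell2 m (R f)" if "f \<in> E" for f
    using that by (simp add: R'_def E'_def to_of_ell2)
  have mem: "of_ell2 m f \<in> E' \<longleftrightarrow> f \<in> E" for f unfolding E'_def using to_of_ell2 by (metis image_iff)
  have ex: "?P (E', R')"
  proof (unfold prod.case, intro conjI allI impI ballI)
    show "selfadjoint m E' R'" unfolding E'_def using real_selfadjoint_back[OF E(1) i app] by simp
    show "nonneg_op m E' R'" using E(2)
      by (auto simp: nonneg_op_def nonneg_on_def E'_def app Re_l2inner of_ell2_l2 to_of_ell2)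
    show "R' u = (\<lambda>x. 0)" if "u \<notin> E'" for u using that by (simp add: R'_def)
    have Deq: "of_ell2 m ` {u \<in> E. R u \<in> E} = D" unfolding E(3)[symmetric] by (rule img[OF Dl2(1)])
    have "{u \<in> E'. R' u \<in> E'} = of_ell2 m ` {f \<in> E. R' (of_ell2 m f) \<in> E'}" unfolding E'_def by blast
    also have "{f \<in> E. R' (of_ell2 m f) \<in> E'} = {f \<in> E. R f \<in> E}" by (auto simp: app mem)
    finally show "D = {u \<in> E'. R' u \<in> E'}" using Deq by simp
    show "R' (R' u) = L u" if u: "u \<in> D" for u
    proof -
      have f: "to_ell2 m u \<in> E" "R (to_ell2 m u) \<in> E" using E(3) u by auto
      have "R' (R' (of_ell2 m (to_ell2 m u))) = of_ell2 m (transfer_op L (to_ell2 m u))"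
        using E(4)[of "to_ell2 m u"] u by (simp add: app f)
      then show ?thesis using u Dl2 by (simp add: of_to_ell2 real(2))
    qed
  qed
  have un: "p = (E', R')" if "?P p" for p
  proof -
    obtain F T where p: "p = (F, T)" by (cases p)
    have F: "selfadjoint m F T" "nonneg_op m F T" "\<And>u. u \<notin> F \<Longrightarrow> T u = (\<lambda>x. 0)"
      "D = {u \<in> F. T u \<in> F}" "\<And>u. u \<in> D \<Longrightarrow> T (T u) = L u" using that unfolding p by auto
    have Fl2: "\<And>u. u \<in> F \<Longrightarrow> u \<in> l2 m" "\<And>u. u \<in> F \<Longrightarrow> T u \<in> l2 m"
      using F(1) unfolding selfadjoint_def linear_op_def l2_subspace_def by blast+
    note rF = selfadjoint_real[OF F(1)]
    have memF: "to_ell2 m u \<in> to_ell2 m ` F \<longleftrightarrow> u \<in> F" if u: "u \<in> l2 m" for u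
    proof
      assume "to_ell2 m u \<in> to_ell2 m ` F"
      then obtain v where v: "v \<in> F" "to_ell2 m u = to_ell2 m v" by (rule imageE)
      have "u = v" using arg_cong[OF v(2), of "of_ell2 m"] by (simp add: of_to_ell2 u Fl2(1)[OF v(1)])
      then show "u \<in> F" using v(1) by simp
    qed simp
    have "nonneg_sqrt (to_ell2 m ` D) (transfer_op L) (to_ell2 m ` F) (transfer_op T)"
      unfolding nonneg_sqrt_def
    proof (intro conjI ballI rF(1) nonneg_op_real[OF F(1,2)])
      have "{f \<in> to_ell2 m ` F. transfer_op T f \<in> to_ell2 m ` F} =
          to_ell2 m ` {u \<in> F. transfer_op T (to_ell2 m u) \<in> to_ell2 m ` F}" by blast
      also have "{u \<in> F. transfer_op T (to_ell2 m u) \<in> to_ell2 m ` F} = {u \<in> F. T u \<in> F}"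
        by (intro Collect_cong conj_cong refl) (simp only: rF(2) memF[OF Fl2(2)])
      finally show "to_ell2 m ` D = {u \<in> to_ell2 m ` F. transfer_op T u \<in> to_ell2 m ` F}"
        unfolding F(4) by (rule sym)
      show "transfer_op T (transfer_op T f) = transfer_op L f" if f: "f \<in> to_ell2 m ` D" for f
      proof -
        obtain u where u: "u \<in> D" "f = to_ell2 m u" using f by blast
        then have "u \<in> F" "T u \<in> F" using F(4) by auto
        then show ?thesis using u F(5) by (simp add: rF(2) real(2))
      qed
    qed
    from uniq[rule_format, OF this]
    have "to_ell2 m ` F = E" and eq: "\<forall>u\<in>E. transfer_op T u = R u" by (rule conjunct1, rule conjunct2)
    then have FE: "to_ell2 m ` F = E" and TR: "\<And>u. u \<in> F \<Longrightarrow> to_ell2 m (T u) = R (to_ell2 m u)"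
      using rF(2) eq by auto
    have F_eq: "F = E'" unfolding E'_def FE[symmetric] using img[OF Fl2(1)] by simp
    have "T u = R' u" for u
    proof (cases "u \<in> F")
      case True
      then show ?thesis using TR[OF True] Fl2 F_eq by (metis R'_def of_to_ell2)
    next
      case False
      then show ?thesis using F(3) F_eq by (simp add: R'_def)
    qed
    then show ?thesis using p F_eq by auto
  qed
  have "?P (op_sqrt m D L)" unfolding op_sqrt_def by (rule theI[of ?P, OF ex un])
  then show "selfadjoint m DS S" "nonneg_op m DS S" "D = {u \<in> DS. S u \<in> DS}" "\<And>u. u \<in> D \<Longrightarrow> S (S u) = L u"
    unfolding DS_def S_def by (auto simp: case_prod_beta)
qed

end

section \<open>Finitely supported functions\<close>

lemma infsum_supported:
  assumes "finite F" "\<And>x. x \<notin> F \<Longrightarrow> f x = 0"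
  shows "infsum f UNIV = sum f F"
  using infsum_cong_neutral[of F UNIV f f] assms by (simp add: infsum_finite)

text \<open>Applied with the factor \<open>sqrt t\<close> to the root of L, so that the graph inner
  product becomes the real part of <.,.> + t Q.\<close>

lemma real_selfadjoint_scale:
  assumes sa: "real_selfadjoint D L" and t: "t \<noteq> 0"
  shows "real_selfadjoint D (\<lambda>u. t *\<^sub>R L u)"
proof -
  have *: "v \<in> D" if H: "\<forall>u\<in>D. inner (t *\<^sub>R L u) v = inner u w" for v w
  proof -
    have "inner (L u) v = inner u ((1 / t) *\<^sub>R w)" if "u \<in> D" for u
      using H[rule_format, OF that] t by (simp add: field_simps)
    then show ?thesis using sa unfolding real_selfadjoint_def by blast
  qed
  show ?thesis
    unfolding real_selfadjoint_def
  proof (intro conjI ballI allI impI)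
    show "subspace D" "closure D = UNIV" using sa unfolding real_selfadjoint_def by blast+
  next
    fix u v a assume "u \<in> D" "v \<in> D"
    moreover from this have "L (u + a *\<^sub>R v) = L u + a *\<^sub>R L v" "inner (L u) v = inner u (L v)"
      using sa unfolding real_selfadjoint_def by blast+
    ultimately show "t *\<^sub>R L (u + a *\<^sub>R v) = t *\<^sub>R L u + a *\<^sub>R t *\<^sub>R L v"
      "inner (t *\<^sub>R L u) v = inner u (t *\<^sub>R L v)"
      by (simp_all add: scaleR_add_right mult.commute)
  qed (rule *)
qed

text \<open>\<open>F\<close> contains the closed neighbourhood of the support of
  \<open>\<phi>\<close>. No edge along which \<open>\<phi>\<close> changes leaves \<open>F\<close>,
  so pairings with \<open>\<phi>\<close> are exact finite sums over \<open>F\<close> even when the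
  other function is arbitrary.\<close>

definition contains_nbhd :: "('v \<Rightarrow> 'v \<Rightarrow> real) \<Rightarrow> 'v set \<Rightarrow> 'v fn \<Rightarrow> bool" where
  "contains_nbhd b F \<phi> \<longleftrightarrow> finite F \<and> (\<forall>x. \<phi> x \<noteq> 0 \<longrightarrow> x \<in> F \<and> {y. 0 < b x y} \<subseteq> F)"

definition energy :: "('v \<Rightarrow> 'v \<Rightarrow> real) \<Rightarrow> ('v \<Rightarrow> real) \<Rightarrow> 'v set \<Rightarrow> 'v fn \<Rightarrow> 'v fn \<Rightarrow> complex" where
  "energy b c F u v = (1/2) * (\<Sum>x\<in>F. \<Sum>y\<in>F. complex_of_real (b x y) * (u x - u y) * cnj (v x - v y))
      + (\<Sum>x\<in>F. complex_of_real (c x) * u x * cnj (v x))"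

lemma energy_cnj: "energy b c F v u = cnj (energy b c F u v)"
  unfolding energy_def by (simp add: mult_ac cnj_sum)

lemma Cc_l2: "\<phi> \<in> Cc \<Longrightarrow> \<phi> \<in> l2 m"
  unfolding Cc_def l2_def mem_Collect_eq
  by (rule finite_nonzero_values_imp_summable_on, rule finite_subset[of _ "{x. \<phi> x \<noteq> 0}"]) auto

lemma Cc_diff: "\<phi> \<in> Cc \<Longrightarrow> \<psi> \<in> Cc \<Longrightarrow> (\<lambda>x. \<phi> x - \<psi> x) \<in> Cc"
  unfolding Cc_def mem_Collect_eq
  by (rule finite_subset[of _ "{x. \<phi> x \<noteq> 0} \<union> {x. \<psi> x \<noteq> 0}"]) auto

section \<open>Green's formula on a locally finite graph\<close>

context
  fixes m :: "'v \<Rightarrow> real" and b :: "'v \<Rightarrow> 'v \<Rightarrow> real" and c :: "'v \<Rightarrow> real"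
  assumes mpos: "\<forall>x. 0 < m x" and graph: "graph_over b c" and lf: "locally_finite b"
begin

lemma b_facts: "0 \<le> b x y" "b x x = 0" "b x y = b y x" "0 \<le> c x"
  using graph unfolding graph_over_def by blast+

lemma contains_nbhd_exists:
  assumes "\<phi> \<in> Cc" "\<psi> \<in> Cc"
  obtains F where "contains_nbhd b F \<phi>" "contains_nbhd b F \<psi>"
proof
  let ?K = "{x. \<phi> x \<noteq> 0} \<union> {x. \<psi> x \<noteq> 0}"
  let ?F = "?K \<union> (\<Union>x\<in>?K. {y. 0 < b x y})"
  have "finite ?F" using assms lf unfolding Cc_def locally_finite_def by auto
  then show "contains_nbhd b ?F \<phi>" "contains_nbhd b ?F \<psi>" unfolding contains_nbhd_def by auto
qed

lemma m_Ltilde: "complex_of_real (m x) * Ltilde b c m u x =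
    (\<Sum>y\<in>{y. 0 < b x y}. complex_of_real (b x y) * (u x - u y)) + complex_of_real (c x) * u x"
  using mpos[rule_format, of x] by (simp add: Ltilde_def field_simps)

lemma nbr_sum_eq:
  assumes "finite F" "\<And>y. 0 < b x y \<Longrightarrow> y \<notin> F \<Longrightarrow> g y = 0"
  shows "(\<Sum>y\<in>{y. 0 < b x y}. complex_of_real (b x y) * g y) = (\<Sum>y\<in>F. complex_of_real (b x y) * g y)"
proof -
  have "(\<Sum>y\<in>{y. 0 < b x y}. complex_of_real (b x y) * g y) =
      (\<Sum>y\<in>{y. 0 < b x y} \<inter> F. complex_of_real (b x y) * g y)"
    using lf assms unfolding locally_finite_def by (intro sum.mono_neutral_right) auto
  also have "\<dots> = (\<Sum>y\<in>F. complex_of_real (b x y) * g y)"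
    using assms(1) b_facts(1)[of x] by (intro sum.mono_neutral_left) (auto simp: less_le)
  finally show ?thesis .
qed

text \<open>Since \<open>b\<close> is symmetric, exchanging x and y flips the sign of
  \<open>u x - u y\<close>. Adding the double sum to its exchanged copy turns
  \<open>cnj (v x)\<close> into \<open>cnj (v x - v y)\<close> and accounts for the factor
  1/2.\<close>

lemma energy_sum_by_parts:
  "(\<Sum>x\<in>F. ((\<Sum>y\<in>F. complex_of_real (b x y) * (u x - u y)) + complex_of_real (c x) * u x) * cnj (v x))
    = energy b c F u v"
proof -
  have half: "p = (1/2) * q" if "p + p = q" for p q :: complex using that[symmetric] by simp
  let ?S = "\<Sum>x\<in>F. \<Sum>y\<in>F. complex_of_real (b x y) * (u x - u y) * cnj (v x)"
  have "?S = (\<Sum>y\<in>F. \<Sum>x\<in>F. complex_of_real (b x y) * (u x - u y) * cnj (v x))" by (rule sum.swap)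
  also have "\<dots> = (\<Sum>x\<in>F. \<Sum>y\<in>F. - (complex_of_real (b x y) * (u x - u y) * cnj (v y)))"
    by (intro sum.cong refl) (simp add: b_facts(3) algebra_simps)
  finally have "?S + ?S = ?S + (\<Sum>x\<in>F. \<Sum>y\<in>F. - (complex_of_real (b x y) * (u x - u y) * cnj (v y)))"
    by (rule arg_cong)
  also have "\<dots> = (\<Sum>x\<in>F. \<Sum>y\<in>F. complex_of_real (b x y) * (u x - u y) * cnj (v x - v y))"
    by (simp add: sum.distrib[symmetric] algebra_simps)
  finally have "?S = (1/2) * (\<Sum>x\<in>F. \<Sum>y\<in>F. complex_of_real (b x y) * (u x - u y) * cnj (v x - v y))"
    by (rule half)
  then show ?thesis
    unfolding energy_def distrib_right sum.distrib sum_distrib_right by simp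
qed

lemma Ltilde_green_left:
  assumes F: "contains_nbhd b F \<phi>"
  shows "l2inner m (Ltilde b c m u) \<phi> = energy b c F u \<phi>"
proof -
  have fin: "finite F" and sup: "\<And>x. \<phi> x \<noteq> 0 \<Longrightarrow> x \<in> F \<and> {y. 0 < b x y} \<subseteq> F"
    using F unfolding contains_nbhd_def by auto
  have "l2inner m (Ltilde b c m u) \<phi> = (\<Sum>x\<in>F. (complex_of_real (m x) * Ltilde b c m u x) * cnj (\<phi> x))"
    unfolding l2inner_def using sup fin by (subst infsum_supported[of F]) (auto simp: mult_ac)
  also have "\<dots> = (\<Sum>x\<in>F. ((\<Sum>y\<in>F. complex_of_real (b x y) * (u x - u y)) + complex_of_real (c x) * u x) * cnj (\<phi> x))"
  proof (intro sum.cong refl)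
    fix x
    show "(complex_of_real (m x) * Ltilde b c m u x) * cnj (\<phi> x) =
        ((\<Sum>y\<in>F. complex_of_real (b x y) * (u x - u y)) + complex_of_real (c x) * u x) * cnj (\<phi> x)"
    proof (cases "\<phi> x = 0")
      case False
      then show ?thesis unfolding m_Ltilde using sup[OF False] by (subst nbr_sum_eq[OF fin]) auto
    qed simp
  qed
  finally show ?thesis unfolding energy_sum_by_parts .
qed

text \<open>With the operator on \<open>\<phi>\<close>, a point can carry a nonzero value only if it
  or a neighbour lies in the support, so it belongs to \<open>F\<close>. The resulting finite
  support puts L~ \<open>\<phi>\<close> in the weighted space, where it can act as an adjoint
  image.\<close>

lemma Ltilde_green_right:
  assumes F: "contains_nbhd b F \<phi>"
  shows "l2inner m u (Ltilde b c m \<phi>) = energy b c F u \<phi>" "Ltilde b c m \<phi> \<in> Cc"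
proof -
  have fin: "finite F" and sup: "\<And>x. \<phi> x \<noteq> 0 \<Longrightarrow> x \<in> F \<and> {y. 0 < b x y} \<subseteq> F"
    using F unfolding contains_nbhd_def by auto
  have 0: "Ltilde b c m \<phi> x = 0" if x: "x \<notin> F" for x
  proof -
    have "\<phi> y = 0" if "0 < b x y" for y using sup[of y] that x b_facts(3)[of x y] by auto
    moreover have "\<phi> x = 0" using sup x by blast
    ultimately show ?thesis by (simp add: Ltilde_def)
  qed
  show "Ltilde b c m \<phi> \<in> Cc" unfolding Cc_def mem_Collect_eq
    by (rule finite_subset[OF _ fin]) (use 0 in blast)
  have "l2inner m (Ltilde b c m \<phi>) u = (\<Sum>x\<in>F. (complex_of_real (m x) * Ltilde b c m \<phi> x) * cnj (u x))"
    unfolding l2inner_def using 0 fin by (subst infsum_supported[of F]) (auto simp: mult_ac)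
  also have "\<dots> = (\<Sum>x\<in>F. ((\<Sum>y\<in>F. complex_of_real (b x y) * (\<phi> x - \<phi> y)) + complex_of_real (c x) * \<phi> x) * cnj (u x))"
  proof (intro sum.cong refl)
    fix x assume "x \<in> F"
    have "\<phi> x - \<phi> y = 0" if "0 < b x y" "y \<notin> F" for y using sup[of x] sup[of y] that
      by (cases "\<phi> x = 0"; cases "\<phi> y = 0") auto
    then show "(complex_of_real (m x) * Ltilde b c m \<phi> x) * cnj (u x) =
        ((\<Sum>y\<in>F. complex_of_real (b x y) * (\<phi> x - \<phi> y)) + complex_of_real (c x) * \<phi> x) * cnj (u x)"
      unfolding m_Ltilde by (subst nbr_sum_eq[OF fin]) auto
  qed
  finally have "l2inner m (Ltilde b c m \<phi>) u = energy b c F \<phi> u" unfolding energy_sum_by_parts .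
  then show "l2inner m u (Ltilde b c m \<phi>) = energy b c F u \<phi>"
    using l2inner_cnj[OF mpos, of u] energy_cnj by metis
qed

lemma qN_eq_energy:
  assumes F: "contains_nbhd b F \<phi>" "contains_nbhd b F \<psi>"
  shows "qN b c \<phi> \<psi> = energy b c F \<phi> \<psi>"
proof -
  have fin: "finite F" and sup: "\<And>x. \<phi> x \<noteq> 0 \<or> \<psi> x \<noteq> 0 \<Longrightarrow> x \<in> F \<and> {y. 0 < b x y} \<subseteq> F"
    using F unfolding contains_nbhd_def by auto
  have Z: "complex_of_real (b x y) * (\<phi> x - \<phi> y) * cnj (\<psi> x - \<psi> y) = 0" if "(x, y) \<notin> F \<times> F" for x y
  proof (rule ccontr)
    assume *: "complex_of_real (b x y) * (\<phi> x - \<phi> y) * cnj (\<psi> x - \<psi> y) \<noteq> 0"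
    then have "0 < b x y" "0 < b y x" using b_facts(1)[of x y] b_facts(3)[of x y] by (auto simp: less_le)
    then show False using sup[of x] sup[of y] that *
      by (cases "\<phi> x = 0 \<and> \<psi> x = 0"; cases "\<phi> y = 0 \<and> \<psi> y = 0") auto
  qed
  have "(\<Sum>\<^sub>\<infinity>(x,y). complex_of_real (b x y) * (\<phi> x - \<phi> y) * cnj (\<psi> x - \<psi> y)) =
      (\<Sum>(x,y)\<in>F\<times>F. complex_of_real (b x y) * (\<phi> x - \<phi> y) * cnj (\<psi> x - \<psi> y))"
  proof (rule infsum_supported)
    show "(case p of (x, y) \<Rightarrow> complex_of_real (b x y) * (\<phi> x - \<phi> y) * cnj (\<psi> x - \<psi> y)) = 0"
      if "p \<notin> F \<times> F" for p
      using Z[of "fst p" "snd p"] that unfolding case_prod_beta prod.collapse by blast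
  qed (use fin in simp)
  moreover have "(\<Sum>\<^sub>\<infinity>x. complex_of_real (c x) * \<phi> x * cnj (\<psi> x)) = (\<Sum>x\<in>F. complex_of_real (c x) * \<phi> x * cnj (\<psi> x))"
    using fin sup by (intro infsum_supported) auto
  ultimately show ?thesis unfolding qN_def energy_def by (simp add: sum.cartesian_product)
qed

end


section \<open>Comparison of the forms\<close>

definition point_fn :: "'v \<Rightarrow> 'v fn" where
  "point_fn y = (\<lambda>x. if x = y then 1 else 0)"

lemma point_fn_Cc: "point_fn y \<in> Cc" by (simp add: Cc_def point_fn_def)

text \<open>Projection to the real axis followed by truncation. Its fixed points are exactly the
  real numbers in [0,1], so being fixed expresses real-valuedness and both bounds at once.\<close>

definition clamp01 :: "complex \<Rightarrow> complex" where
  "clamp01 s = complex_of_real (min (max (Re s) 0) 1)"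

lemma normal_contraction_clamp01: "normal_contraction clamp01"
  unfolding normal_contraction_def
proof (intro conjI allI)
  fix s t
  have "cmod (clamp01 s - clamp01 t) = \<bar>min (max (Re s) 0) 1 - min (max (Re t) 0) 1\<bar>"
    unfolding clamp01_def of_real_diff[symmetric] norm_of_real ..
  also have "\<dots> \<le> \<bar>Re (s - t)\<bar>" by (auto simp: min_def max_def)
  also have "\<dots> \<le> cmod (s - t)" by (rule abs_Re_le_cmod)
  finally show "cmod (clamp01 s - clamp01 t) \<le> cmod (s - t)" .
qed (simp add: clamp01_def)

text \<open>Polarisation, 2 Re(z cnj w) = |z|^2 + |w|^2 - |z - w|^2, presents a symmetric matrix as
  a graph form with edge weights \<open>- a x y\<close> and column sums as killing term.\<close>

lemma symmetric_quadratic_form_by_differences: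
  fixes a :: "'v \<Rightarrow> 'v \<Rightarrow> real" and u :: "'v \<Rightarrow> complex"
  assumes sym: "\<And>x y. x \<in> K \<Longrightarrow> y \<in> K \<Longrightarrow> a x y = a y x"
  shows "(\<Sum>x\<in>K. \<Sum>y\<in>K. a x y * Re (u x * cnj (u y))) =
    (\<Sum>y\<in>K. (\<Sum>x\<in>K. a x y) * (cmod (u y))\<^sup>2) - (1/2) * (\<Sum>x\<in>K. \<Sum>y\<in>K. a x y * (cmod (u x - u y))\<^sup>2)"
proof -
  have polar: "2 * Re (z * cnj w) = (cmod z)\<^sup>2 + (cmod w)\<^sup>2 - (cmod (z - w))\<^sup>2" for z w
    by (simp add: cmod_power2) (simp add: power2_eq_square algebra_simps)
  have "2 * (\<Sum>x\<in>K. \<Sum>y\<in>K. a x y * Re (u x * cnj (u y))) = (\<Sum>x\<in>K. \<Sum>y\<in>K. a x y * (2 * Re (u x * cnj (u y))))"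
    by (simp only: sum_distrib_left mult.left_commute[of 2])
  also have "\<dots> = (\<Sum>x\<in>K. \<Sum>y\<in>K. a x y * (cmod (u x))\<^sup>2) + (\<Sum>x\<in>K. \<Sum>y\<in>K. a x y * (cmod (u y))\<^sup>2)
      - (\<Sum>x\<in>K. \<Sum>y\<in>K. a x y * (cmod (u x - u y))\<^sup>2)"
    unfolding polar by (simp add: sum.distrib sum_subtractf algebra_simps)
  also have "(\<Sum>x\<in>K. \<Sum>y\<in>K. a x y * (cmod (u x))\<^sup>2) = (\<Sum>x\<in>K. \<Sum>y\<in>K. a y x * (cmod (u x))\<^sup>2)"
    by (intro sum.cong refl) (simp add: sym)
  also have "\<dots> = (\<Sum>y\<in>K. (\<Sum>x\<in>K. a x y) * (cmod (u y))\<^sup>2)" by (simp add: sum_distrib_right)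
  also have "(\<Sum>x\<in>K. \<Sum>y\<in>K. a x y * (cmod (u y))\<^sup>2) = (\<Sum>y\<in>K. (\<Sum>x\<in>K. a x y) * (cmod (u y))\<^sup>2)"
    by (subst sum.swap) (simp add: sum_distrib_right)
  finally show ?thesis by simp
qed

lemma clamp01_fixed: "clamp01 s = s \<Longrightarrow> 0 \<le> Re s \<and> Re s \<le> 1 \<and> Im s = 0"
  unfolding clamp01_def by (metis Im_complex_of_real Re_complex_of_real max.cobounded2 min.boundedI min.cobounded2 zero_le_one)

context
  fixes m :: "'v \<Rightarrow> real" and b :: "'v \<Rightarrow> 'v \<Rightarrow> real" and c :: "'v \<Rightarrow> real"
    and D :: "'v fn set" and L :: "'v fn \<Rightarrow> 'v fn"
  assumes mpos: "\<forall>x. 0 < m x" and graph: "graph_over b c" and lf: "locally_finite b"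
    and sa: "selfadjoint m D L" and nn: "nonneg_op m D L"
    and restr: "\<forall>u\<in>D. L u = Ltilde b c m u"
    and dir: "dirichlet_form m (assoc_form_dom m D L) (assoc_form m D L)"
begin

abbreviation (input) "DQ \<equiv> assoc_form_dom m D L"
abbreviation (input) "Q \<equiv> assoc_form m D L"
abbreviation (input) "S \<equiv> snd (op_sqrt m D L)"

lemma S_selfadjoint: "selfadjoint m DQ S"
  unfolding assoc_form_dom_def by (rule op_sqrt_spec(1)[OF mpos sa nn])

lemma DQ_l2: "u \<in> DQ \<Longrightarrow> u \<in> l2 m" and S_l2: "u \<in> DQ \<Longrightarrow> S u \<in> l2 m"
  and S_sym: "u \<in> DQ \<Longrightarrow> v \<in> DQ \<Longrightarrow> l2inner m (S u) v = l2inner m u (S v)"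
  and S_lin: "u \<in> DQ \<Longrightarrow> v \<in> DQ \<Longrightarrow> S (\<lambda>x. u x + a * v x) = (\<lambda>x. S u x + a * S v x)"
  and DQ_sub: "l2_subspace m DQ"
  using S_selfadjoint unfolding selfadjoint_def linear_op_def l2_subspace_def by blast+

lemmas DQ_closed = l2_subspaceD[OF mpos DQ_sub]

lemma D_DQ: "u \<in> D \<Longrightarrow> u \<in> DQ \<and> S u \<in> DQ \<and> S (S u) = L u"
  using op_sqrt_spec(3,4)[OF mpos sa nn] unfolding assoc_form_dom_def by blast

text \<open>Green's formula exhibits L~ \<open>\<phi>\<close> as the adjoint image of
  \<open>\<phi>\<close>, and the adjoint of \<open>L\<close> has domain \<open>D\<close>.\<close>

lemma Cc_D: assumes "\<phi> \<in> Cc" shows "\<phi> \<in> D"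
proof -
  obtain F where F: "contains_nbhd b F \<phi>"
    using contains_nbhd_exists[OF mpos graph lf assms assms] by blast
  have "l2inner m (L u) \<phi> = l2inner m u (Ltilde b c m \<phi>)" if "u \<in> D" for u
    using restr that Ltilde_green_left[OF mpos graph lf F, of u] Ltilde_green_right(1)[OF mpos graph lf F, of u] by simp
  then have "\<phi> \<in> adjoint_dom m D L"
    unfolding adjoint_dom_def using Cc_l2 assms Ltilde_green_right(2)[OF mpos graph lf F] by blast
  then show ?thesis using sa unfolding selfadjoint_def by blast
qed

lemma Cc_DQ: "\<phi> \<in> Cc \<Longrightarrow> \<phi> \<in> DQ" using Cc_D D_DQ by blast

text \<open>Since \<open>\<phi>\<close> is in \<open>D\<close>, one root can be moved across: <S u,
  S \<open>\<phi>\<close>> = <u, L \<open>\<phi>\<close>>. Green's formula then shifts L~ onto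
  \<open>u\<close>, which need only lie in the form domain.\<close>

lemma Q_Cc_right:
  assumes u: "u \<in> DQ" and F: "contains_nbhd b F \<phi>"
  shows "Q u \<phi> = energy b c F u \<phi>" "Q u \<phi> = l2inner m (Ltilde b c m u) \<phi>"
proof -
  have "\<phi> \<in> Cc" using F unfolding contains_nbhd_def Cc_def by (auto elim: rev_finite_subset)
  then have D: "\<phi> \<in> D" by (rule Cc_D)
  then have "Q u \<phi> = l2inner m u (Ltilde b c m \<phi>)"
    unfolding assoc_form_def using S_sym[OF u] D_DQ[OF D] restr by simp
  then show "Q u \<phi> = energy b c F u \<phi>" using Ltilde_green_right(1)[OF mpos graph lf F] by simp
  then show "Q u \<phi> = l2inner m (Ltilde b c m u) \<phi>" using Ltilde_green_left[OF mpos graph lf F] by simp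
qed

lemma Q_Cc: "\<phi> \<in> Cc \<Longrightarrow> \<psi> \<in> Cc \<Longrightarrow> Q \<phi> \<psi> = qN b c \<phi> \<psi>"
  using contains_nbhd_exists[OF mpos graph lf, of \<phi> \<psi>] Q_Cc_right(1)[OF Cc_DQ] qN_eq_energy[OF mpos graph lf]
  by metis

lemma Re_Q_self: "u \<in> DQ \<Longrightarrow> Re (Q u u) = (norm (to_ell2 m (S u)))\<^sup>2"
  unfolding assoc_form_def by (simp add: Re_l2inner[OF mpos] S_l2 power2_norm_eq_inner)

section \<open>Upper bound: the closure of the form on finitely supported functions\<close>

lemma form_le_QD: "form_le DQ Q (domD m b c) (qD m b c)"
proof -
  have main: "u \<in> DQ \<and> qD m b c u u = Q u u" if "u \<in> domD m b c" for u
  proof -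
    obtain s where u: "u \<in> l2 m" and s: "approxD m b c s u" using \<open>u \<in> domD m b c\<close> unfolding domD_def by blast
    have conv: "u \<in> DQ \<and> (\<lambda>n. to_ell2 m (S (s n))) \<longlonglongrightarrow> to_ell2 m (S u)" if s: "approxD m b c s u" for s
    proof -
      have sCc: "s n \<in> Cc" for n using s unfolding approxD_def by blast
      have "form_cauchy Q s" using s unfolding approxD_def form_cauchy_def
        by (simp add: Q_Cc Cc_diff)
      then have cl: "u \<in> DQ \<and> (\<lambda>n. Re (Q (\<lambda>x. s n x - u x) (\<lambda>x. s n x - u x))) \<longlonglongrightarrow> 0"
        using dir s u Cc_DQ sCc unfolding dirichlet_form_def closed_form_def approxD_def by blast
      then have uD: "u \<in> DQ" by blast
      have "to_ell2 m (S (\<lambda>x. s n x - u x)) = to_ell2 m (S (s n)) - to_ell2 m (S u)" for n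
        using S_lin[OF Cc_DQ[OF sCc[of n]] uD, of "-1"] to_ell2_diff[OF mpos S_l2[OF Cc_DQ[OF sCc]] S_l2[OF uD]] by simp
      then have "Re (Q (\<lambda>x. s n x - u x) (\<lambda>x. s n x - u x)) = (norm (to_ell2 m (S (s n)) - to_ell2 m (S u)))\<^sup>2" for n
        using Re_Q_self DQ_closed(5)[OF Cc_DQ[OF sCc] uD] by simp
      then have "(\<lambda>n. (norm (to_ell2 m (S (s n)) - to_ell2 m (S u)))\<^sup>2) \<longlonglongrightarrow> 0" using cl by simp
      then have "(\<lambda>n. sqrt ((norm (to_ell2 m (S (s n)) - to_ell2 m (S u)))\<^sup>2)) \<longlonglongrightarrow> sqrt 0"
        by (rule tendsto_real_sqrt)
      then have "(\<lambda>n. to_ell2 m (S (s n))) \<longlonglongrightarrow> to_ell2 m (S u)"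
        by (simp add: tendsto_norm_zero_iff LIM_zero_iff)
      then show ?thesis using uD by blast
    qed
    have uD: "u \<in> DQ" using conv s by blast
    \<comment> \<open>The description of \<open>qD\<close> quantifies over pairs of approximating
      sequences, so the limit is needed for independent \<open>s\<close> and \<open>t\<close>. By
      \<open>conv\<close> the images under the root converge in norm, hence so do their inner
      products.\<close>
    have lim: "(\<lambda>n. qN b c (s n) (t n)) \<longlonglongrightarrow> Q u u" if st: "approxD m b c s u" "approxD m b c t u" for s t
    proof -
      have sCc: "s n \<in> Cc" "t n \<in> Cc" for n using st unfolding approxD_def by blast+
      note cs = conv[OF st(1), THEN conjunct2] and ct = conv[OF st(2), THEN conjunct2]
      have ReIm: "Q v w = Complex (inner (to_ell2 m (S v)) (to_ell2 m (S w))) (- inner (ell2_i (to_ell2 m (S v))) (to_ell2 m (S w)))"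
        if "v \<in> DQ" "w \<in> DQ" for v w
        using that by (simp add: complex_eq_iff assoc_form_def Re_l2inner[OF mpos] Im_l2inner[OF mpos] S_l2)
      have "(\<lambda>n. Q (s n) (t n)) \<longlonglongrightarrow> Q u u"
        unfolding ReIm[OF uD uD] ReIm[OF Cc_DQ[OF sCc(1)] Cc_DQ[OF sCc(2)]]
        by (intro tendsto_Complex tendsto_intros cs ct)
      then show ?thesis using sCc by (simp add: Q_Cc)
    qed
    have "qD m b c u u = Q u u"
      unfolding qD_def
    proof (rule the_equality)
      show "\<forall>s t. approxD m b c s u \<and> approxD m b c t u \<longrightarrow> (\<lambda>n. qN b c (s n) (t n)) \<longlonglongrightarrow> Q u u"
        using lim by blast
      show "z = Q u u" if "\<forall>s t. approxD m b c s u \<and> approxD m b c t u \<longrightarrow> (\<lambda>n. qN b c (s n) (t n)) \<longlonglongrightarrow> z" for z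
        using that s lim LIMSEQ_unique by blast
    qed
    then show ?thesis using uD by blast
  qed
  then show ?thesis unfolding form_le_def by auto
qed

text \<open>Up to the factor t, this is the form Q regularised by 1/t times the squared norm.\<close>

definition QT :: "real \<Rightarrow> 'v fn \<Rightarrow> 'v fn \<Rightarrow> complex" where
  "QT t u v = l2inner m u v + complex_of_real t * Q u v"

lemma QT_lin: "u \<in> DQ \<Longrightarrow> v \<in> DQ \<Longrightarrow> w \<in> DQ \<Longrightarrow> QT t (\<lambda>x. u x + a * v x) w = QT t u w + a * QT t v w"
  unfolding QT_def assoc_form_def
  by (simp add: S_lin l2inner_lin_left[OF mpos] DQ_l2 S_l2 algebra_simps)

lemma QT_cnj: "QT t v u = cnj (QT t u v)"
  unfolding QT_def assoc_form_def using l2inner_cnj[OF mpos, of u v] l2inner_cnj[OF mpos, of "S u" "S v"] by simp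

lemma QT_lin_right: "u \<in> DQ \<Longrightarrow> v \<in> DQ \<Longrightarrow> w \<in> DQ \<Longrightarrow> QT t w (\<lambda>x. u x + a * v x) = QT t w u + cnj a * QT t w v"
  using QT_lin[of u v w t a] by (simp add: QT_cnj[of t w])

lemma QT_sum:
  assumes "finite K" "\<And>x. x \<in> K \<Longrightarrow> h x \<in> DQ" "w \<in> DQ"
  shows "(\<lambda>z. \<Sum>x\<in>K. a x * h x z) \<in> DQ \<and> QT t (\<lambda>z. \<Sum>x\<in>K. a x * h x z) w = (\<Sum>x\<in>K. a x * QT t (h x) w)"
  using assms(1,2)
proof (induction K)
  case empty
  have "QT t (\<lambda>z. 0) w = 0" using QT_lin[OF DQ_closed(2) DQ_closed(2) assms(3), of t 1] by simp
  then show ?case using DQ_closed(2) by simp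
next
  case (insert y K)
  then have IH: "(\<lambda>z. \<Sum>x\<in>K. a x * h x z) \<in> DQ" "QT t (\<lambda>z. \<Sum>x\<in>K. a x * h x z) w = (\<Sum>x\<in>K. a x * QT t (h x) w)"
    and y: "h y \<in> DQ" by auto
  have "(\<lambda>z. \<Sum>x\<in>insert y K. a x * h x z) = (\<lambda>z. (\<Sum>x\<in>K. a x * h x z) + a y * h y z)"
    using insert by (simp add: add.commute)
  then show ?case using DQ_closed(3)[OF IH(1) y, of "a y"] QT_lin[OF IH(1) y assms(3), of t "a y"] IH(2) insert
    by (simp add: add.commute)
qed

lemma QT_self_ge: "u \<in> DQ \<Longrightarrow> 0 \<le> t \<Longrightarrow> (norm (to_ell2 m u))\<^sup>2 \<le> Re (QT t u u)"
  unfolding QT_def by (simp add: Re_l2inner[OF mpos] DQ_l2 power2_norm_eq_inner[symmetric] Re_Q_self)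

lemma QT_pythagoras:
  assumes "u \<in> DQ" "v \<in> DQ" "QT t u v = 0"
  shows "QT t (\<lambda>x. u x + v x) (\<lambda>x. u x + v x) = QT t u u + QT t v v"
proof -
  have "QT t v u = 0" using assms(3) QT_cnj[of t v u] by simp
  then show ?thesis
    using QT_lin[OF assms(1,2) DQ_closed(3)[OF assms(1,2), of 1], of t 1]
      QT_lin_right[OF assms(1,2) assms(1), of t 1] QT_lin_right[OF assms(1,2) assms(2), of t 1] assms(3) by simp
qed

section \<open>Lower bound: harmonic extensions from finite sets and the trace form\<close>

lemma harmonic_extension:
  assumes t: "0 < t" and a: "a \<in> DQ"
  obtains h where "h \<in> DQ" "\<And>x. x \<in> K \<Longrightarrow> h x = a x"
    "\<And>v. v \<in> DQ \<Longrightarrow> (\<And>x. x \<in> K \<Longrightarrow> v x = 0) \<Longrightarrow> QT t h v = 0"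
proof -
  note real = selfadjoint_real[OF mpos S_selfadjoint]
  let ?E = "to_ell2 m ` DQ" and ?T = "\<lambda>f. sqrt t *\<^sub>R transfer_op m S f"
  \<comment> \<open>The graph inner product of \<open>?T\<close> is the real part of
    \<open>QT t\<close>. The harmonic extension is then the orthogonal representative of
    \<open>a\<close> modulo the closed subspace of functions vanishing on \<open>K\<close>.\<close>
  have saT: "real_selfadjoint ?E ?T"
    using real_selfadjoint_scale[OF real(1), of "sqrt t"] t by simp
  define W where "W = (\<Inter>x\<in>K. {f :: 'v ell2. ell2_fun f x = 0})"
  have "closed {f :: 'v ell2. ell2_fun f x = 0}" for x
    by (intro closed_Collect_eq continuous_on_const linear_continuous_on bounded_linear_ell2_coord)
  then have W: "closed W" unfolding W_def by blast
  have W': "subspace W" unfolding W_def subspace_def by (auto simp: ell2_fun_0 ell2_fun_add ell2_fun_scaleR)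
  obtain f where f: "f \<in> ?E" "f - to_ell2 m a \<in> W"
    and o: "\<And>v. v \<in> ?E \<Longrightarrow> v \<in> W \<Longrightarrow> inner f v + inner (?T f) (?T v) = 0"
    using sa_orthogonal_representative[OF saT W W', of "to_ell2 m a"] a by blast
  obtain h where h: "h \<in> DQ" "f = to_ell2 m h" using f(1) by blast
  have sq: "complex_of_real (sqrt (m x)) \<noteq> 0" for x by (rule sqrt_m(1)[OF mpos])
  have "h x = a x" if "x \<in> K" for x
  proof -
    have "ell2_fun (f - to_ell2 m a) x = 0" using f(2) that unfolding W_def by blast
    then have "(h x - a x) * complex_of_real (sqrt (m x)) = 0"
      using h a by (simp add: ell2_fun_diff ell2_fun_to[OF mpos] DQ_l2 algebra_simps)
    then show ?thesis using sq by simp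
  qed
  moreover have "QT t h v = 0" if v: "v \<in> DQ" "\<And>x. x \<in> K \<Longrightarrow> v x = 0" for v
  proof -
    have Re: "Re (QT t h v) = 0" if v: "v \<in> DQ" "\<And>x. x \<in> K \<Longrightarrow> v x = 0" for v
    proof -
      have "to_ell2 m v \<in> W" unfolding W_def using v by (simp add: ell2_fun_to[OF mpos] DQ_l2)
      from o[OF imageI[OF v(1)] this]
      have "inner (to_ell2 m h) (to_ell2 m v) + t * inner (to_ell2 m (S h)) (to_ell2 m (S v)) = 0"
        using t h v by (simp add: real(2) flip: mult.assoc)
      then show ?thesis
        unfolding QT_def assoc_form_def using h v by (simp add: Re_l2inner[OF mpos] DQ_l2 S_l2)
    qed
    \<comment> \<open>Testing with i times \<open>v\<close>, which also vanishes on
      \<open>K\<close>, turns the vanishing of real parts into full orthogonality.\<close>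
    have "QT t h (\<lambda>x. \<i> * v x) = - \<i> * QT t h v"
      using QT_lin_right[OF DQ_closed(2) v(1) h(1), of t \<i>] QT_lin_right[OF DQ_closed(2) DQ_closed(2) h(1), of t 1] by simp
    then have "Re (- \<i> * QT t h v) = 0" using Re[OF DQ_closed(4)[OF v(1), of \<i>]] v(2) by simp
    then show ?thesis using Re[OF v] by (simp add: complex_eq_iff)
  qed
  ultimately show ?thesis using that h(1) by blast
qed

text \<open>A maximum principle. Truncation keeps the values on \<open>K\<close> and increases
  neither Q nor the norm, while by orthogonality \<open>h\<close> is the minimiser for those values.
  Pythagoras leaves no energy for the difference \<open>v\<close>, and the norm contained in
  \<open>QT t\<close> forces \<open>v\<close> to vanish everywhere.\<close>

lemma clamp01_harmonic:
  assumes t: "0 < t" and h: "h \<in> DQ" "\<And>x. x \<in> K \<Longrightarrow> clamp01 (h x) = h x"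
    and o: "\<And>v. v \<in> DQ \<Longrightarrow> (\<And>x. x \<in> K \<Longrightarrow> v x = 0) \<Longrightarrow> QT t h v = 0"
  shows "clamp01 (h x) = h x"
proof -
  let ?g = "clamp01 \<circ> h"
  have g: "?g \<in> DQ" "Re (Q ?g ?g) \<le> Re (Q h h)"
    using dir h normal_contraction_clamp01 unfolding dirichlet_form_def by blast+
  define v where "v = (\<lambda>x. ?g x - h x)"
  have v: "v \<in> DQ" "\<And>x. x \<in> K \<Longrightarrow> v x = 0"
    unfolding v_def using DQ_closed(5)[OF g(1) h(1)] h(2) by auto
  have "cmod (clamp01 s) \<le> cmod s" for s
    using normal_contraction_clamp01 unfolding normal_contraction_def by (metis diff_zero)
  moreover have e: "Re (l2inner m w w) = (\<Sum>\<^sub>\<infinity>x. (cmod (ell2_fun (to_ell2 m w) x))\<^sup>2)" if "w \<in> DQ" for w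
    using that by (simp add: Re_l2inner[OF mpos] DQ_l2 ell2_inner_self)
  ultimately have "Re (l2inner m ?g ?g) \<le> Re (l2inner m h h)"
    using g h unfolding e[OF g(1)] e[OF h(1)]
    by (intro infsum_mono ell2_fun_summable)
      (auto simp: ell2_fun_to[OF mpos] DQ_l2 norm_mult power_mult_distrib mult_right_mono)
  then have "Re (QT t ?g ?g) \<le> Re (QT t h h)" using g(2) t by (simp add: QT_def mult_left_mono add_mono)
  moreover have "?g = (\<lambda>x. h x + v x)" by (simp add: v_def fun_eq_iff)
  ultimately have "Re (QT t v v) \<le> 0" using QT_pythagoras[OF h(1) v(1) o[OF v]] by simp
  then have "(norm (to_ell2 m v))\<^sup>2 \<le> 0" using QT_self_ge[OF v(1), of t] t by linarith
  then have "to_ell2 m v = 0" by simp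
  then have "v x = 0" using of_to_ell2[OF mpos DQ_l2[OF v(1)]] by (metis (no_types, lifting) div_0 ell2_fun_0 of_ell2_def)
  then show ?thesis by (simp add: v_def)
qed


text \<open>Testing against a point reads off \<open>m y\<close> times L~ \<open>w\<close> at
  \<open>y\<close>, which cancels the factor 1/m; L~ \<open>w\<close> need not be square-summable
  for this.\<close>

lemma QT_point:
  assumes w: "w \<in> DQ"
  shows "QT t w (point_fn y) = complex_of_real (m y) * w y + complex_of_real t *
    ((\<Sum>z\<in>{z. 0 < b y z}. complex_of_real (b y z) * (w y - w z)) + complex_of_real (c y) * w y)"
proof -
  obtain F where F: "contains_nbhd b F (point_fn y)"
    using contains_nbhd_exists[OF mpos graph lf point_fn_Cc point_fn_Cc] by blast
  have pt: "l2inner m u (point_fn y) = complex_of_real (m y) * u y" for u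
    unfolding l2inner_def by (subst infsum_supported[of "{y}"]) (auto simp: point_fn_def)
  show ?thesis unfolding QT_def Q_Cc_right(2)[OF w F] pt m_Ltilde[OF mpos graph lf] ..
qed

lemma finite_energy_le_QT:
  assumes u: "u \<in> DQ" and K: "finite K" and t: "0 < t"
  shows "t * ((1/2) * (\<Sum>x\<in>K. \<Sum>y\<in>K. b x y * (cmod (u x - u y))\<^sup>2) + (\<Sum>x\<in>K. c x * (cmod (u x))\<^sup>2))
    \<le> Re (QT t u u)"
proof -
  note b = b_facts[OF mpos graph lf]
  have "\<exists>h. h \<in> DQ \<and> (\<forall>y\<in>K. h y = point_fn x y) \<and>
      (\<forall>v\<in>DQ. (\<forall>y\<in>K. v y = 0) \<longrightarrow> QT t h v = 0)" for x
    using harmonic_extension[OF t Cc_DQ[OF point_fn_Cc[of x]], of K] by metis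
  then obtain H where H: "\<And>x. H x \<in> DQ" "\<And>x y. y \<in> K \<Longrightarrow> H x y = point_fn x y"
    and ort: "\<And>x v. v \<in> DQ \<Longrightarrow> (\<And>y. y \<in> K \<Longrightarrow> v y = 0) \<Longrightarrow> QT t (H x) v = 0" by metis
  have lin: "(\<lambda>z. \<Sum>x\<in>K. \<alpha> x * H x z) \<in> DQ"
    "w \<in> DQ \<Longrightarrow> QT t (\<lambda>z. \<Sum>x\<in>K. \<alpha> x * H x z) w = (\<Sum>x\<in>K. \<alpha> x * QT t (H x) w)" for \<alpha> w
    using QT_sum[of K H "\<lambda>x. 0" \<alpha> t] QT_sum[of K H w \<alpha> t] K H(1) DQ_closed(2) by blast+
  have linK: "(\<Sum>x\<in>K. \<alpha> x * H x y) = \<alpha> y" if "y \<in> K" for \<alpha> y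
  proof -
    have "(\<Sum>x\<in>K. \<alpha> x * H x y) = (\<Sum>x\<in>K. if x = y then \<alpha> x else 0)"
      using that by (intro sum.cong refl) (auto simp: H(2) point_fn_def)
    then show ?thesis using K that by simp
  qed
  have Hr: "0 \<le> Re (H x z) \<and> Re (H x z) \<le> 1 \<and> Im (H x z) = 0" for x z
  proof (rule clamp01_fixed, rule clamp01_harmonic[OF t H(1) _ ort])
    show "clamp01 (H x y) = H x y" if "y \<in> K" for y
      using H(2)[OF that] by (simp add: point_fn_def clamp01_def)
  qed
  \<comment> \<open>The harmonic extension of the constant 1 on \<open>K\<close>. Its bound by 1
    controls the column sums, which the separate bounds on the summands would not. The factor 1
    matches the shape of \<open>lin\<close>.\<close>
  define g where "g = (\<lambda>z. \<Sum>x\<in>K. 1 * H x z)"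
  have gr: "Re (g z) \<le> 1" for z
  proof -
    have "clamp01 (g z) = g z"
    proof (rule clamp01_harmonic[OF t])
      show "g \<in> DQ" unfolding g_def by (rule lin(1))
      show "clamp01 (g y) = g y" if "y \<in> K" for y
        unfolding g_def linK[OF that] by (simp add: clamp01_def)
      show "QT t g v = 0" if "v \<in> DQ" "\<And>y. y \<in> K \<Longrightarrow> v y = 0" for v
        unfolding g_def using lin(2)[OF that(1), of "\<lambda>_. 1"] ort that by simp
    qed
    then show ?thesis using clamp01_fixed by blast
  qed
  define a where "a x y = Re (QT t (H x) (point_fn y))" for x y
  \<comment> \<open>The entries are real because the harmonic functions are, by \<open>Hr\<close>;
    only then can they be compared with \<open>b\<close> and \<open>c\<close>.\<close>
  have A: "QT t (H x) (point_fn y) = complex_of_real (a x y)" for x y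
    unfolding a_def by (simp add: complex_eq_iff) (simp add: QT_point[OF H(1)] Hr)
  have AH: "QT t (H x) (H y) = complex_of_real (a x y)" if "y \<in> K" for x y
  proof -
    have P: "point_fn y \<in> DQ" by (rule Cc_DQ[OF point_fn_Cc])
    let ?v = "\<lambda>z. H y z - point_fn y z"
    have v: "?v \<in> DQ" by (rule DQ_closed(5)[OF H(1) P])
    have "QT t (H x) ?v = 0" by (rule ort[OF v]) (simp add: H(2))
    then show ?thesis using QT_lin_right[OF P v H(1), of t x 1] A by simp
  qed
  have sym: "a x y = a y x" if "x \<in> K" "y \<in> K" for x y
    using QT_cnj[of t "H x" "H y"] unfolding AH[OF that(1)] AH[OF that(2)] by simp
  \<comment> \<open>As \<open>H x\<close> vanishes at \<open>y\<close>, only its values at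
    neighbours of \<open>y\<close> enter. All are nonnegative, and the term \<open>z = x\<close>,
    present when there is an edge, contributes \<open>b y x\<close> since
    \<open>H x x = 1\<close>.\<close>
  have off: "a x y \<le> - t * b x y" if "x \<in> K" "y \<in> K" "x \<noteq> y" for x y
  proof -
    have fin: "finite {z. 0 < b y z}" using lf unfolding locally_finite_def by blast
    have le: "b y x \<le> (\<Sum>z\<in>{z. 0 < b y z}. b y z * Re (H x z))"
    proof (cases "0 < b y x")
      case True
      have "b y x = b y x * Re (H x x)" using that by (simp add: H(2) point_fn_def)
      also have "\<dots> \<le> (\<Sum>z\<in>{z. 0 < b y z}. b y z * Re (H x z))"
        using True Hr by (intro member_le_sum fin) (auto intro: mult_nonneg_nonneg b)
      finally show ?thesis .
    next
      case False
      then have "b y x = 0" using b(1)[of y x] by simp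
      then show ?thesis using Hr b by (auto intro!: sum_nonneg mult_nonneg_nonneg)
    qed
    have "a x y = - t * (\<Sum>z\<in>{z. 0 < b y z}. b y z * Re (H x z))"
      unfolding a_def QT_point[OF H(1)] using that by (simp add: H(2) point_fn_def sum_negf)
    then show ?thesis using mult_left_mono[OF le, of t] t b(3)[of x y] by simp
  qed
  \<comment> \<open>By linearity the column sum is the pairing of \<open>g\<close> with the point
    function at \<open>y\<close>, where \<open>g y = 1\<close>. Besides \<open>t * c y\<close> it
    contains only \<open>m y\<close> and the terms with \<open>1 - Re (g z)\<close>, all
    nonnegative.\<close>
  have col: "t * c y \<le> (\<Sum>x\<in>K. a x y)" if "y \<in> K" for y
  proof -
    have "(\<Sum>x\<in>K. a x y) = Re (QT t g (point_fn y))"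
      unfolding g_def lin(2)[OF Cc_DQ[OF point_fn_Cc]] by (simp add: A)
    also have "\<dots> = m y + t * ((\<Sum>z\<in>{z. 0 < b y z}. b y z * (1 - Re (g z))) + c y)"
      using QT_point[of g t y] lin(1)[of "\<lambda>_. 1"] linK[OF that, of "\<lambda>_. 1"] by (simp add: g_def)
    also have "\<dots> \<ge> t * c y"
    proof -
      have "0 \<le> (\<Sum>z\<in>{z. 0 < b y z}. b y z * (1 - Re (g z)))"
        using gr b by (auto intro!: sum_nonneg mult_nonneg_nonneg)
      then show ?thesis using mpos[rule_format, of y] t by (simp add: distrib_left)
    qed
    finally show ?thesis .
  qed
  define p where "p = (\<lambda>z. \<Sum>x\<in>K. u x * H x z)"
  have p: "p \<in> DQ" unfolding p_def by (rule lin(1))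
  let ?v = "\<lambda>z. u z - p z"
  have v: "?v \<in> DQ" by (rule DQ_closed(5)[OF u p])
  have "QT t p ?v = 0"
    unfolding p_def lin(2)[OF v[unfolded p_def]] using ort[OF v] linK by (simp add: p_def)
  from QT_pythagoras[OF p v this] have "Re (QT t u u) = Re (QT t p p) + Re (QT t ?v ?v)" by simp
  then have "Re (QT t p p) \<le> Re (QT t u u)" using QT_self_ge[OF v, of t] t by (simp add: order_trans[OF zero_le_power2])
  moreover have "QT t p p = (\<Sum>x\<in>K. \<Sum>y\<in>K. complex_of_real (a x y) * (u x * cnj (u y)))"
  proof -
    have "QT t (H x) p = (\<Sum>y\<in>K. cnj (u y) * complex_of_real (a x y))" if "x \<in> K" for x
    proof -
      have "QT t p (H x) = (\<Sum>y\<in>K. u y * complex_of_real (a y x))"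
        unfolding p_def lin(2)[OF H(1)] AH[OF that] ..
      then show ?thesis using QT_cnj[of t "H x" p] sym that by (simp add: cnj_sum)
    qed
    then have "QT t p p = (\<Sum>x\<in>K. u x * (\<Sum>y\<in>K. cnj (u y) * complex_of_real (a x y)))"
      using lin(2)[OF p, of u] unfolding p_def by simp
    then show ?thesis by (simp add: sum_distrib_left mult_ac)
  qed
  moreover have "t * ((1/2) * (\<Sum>x\<in>K. \<Sum>y\<in>K. b x y * (cmod (u x - u y))\<^sup>2) + (\<Sum>x\<in>K. c x * (cmod (u x))\<^sup>2))
      \<le> (\<Sum>x\<in>K. \<Sum>y\<in>K. a x y * Re (u x * cnj (u y)))"
  proof -
    \<comment> \<open>On the diagonal the difference of \<open>u\<close> vanishes, so the estimate
      \<open>off\<close> for distinct points is enough.\<close>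
    have "(\<Sum>x\<in>K. \<Sum>y\<in>K. a x y * (cmod (u x - u y))\<^sup>2) \<le> (\<Sum>x\<in>K. \<Sum>y\<in>K. - t * b x y * (cmod (u x - u y))\<^sup>2)"
    proof (intro sum_mono)
      fix x y assume "x \<in> K" "y \<in> K"
      then show "a x y * (cmod (u x - u y))\<^sup>2 \<le> - t * b x y * (cmod (u x - u y))\<^sup>2"
        by (cases "x = y") (simp, intro mult_right_mono off, auto)
    qed
    also have "\<dots> = - t * (\<Sum>x\<in>K. \<Sum>y\<in>K. b x y * (cmod (u x - u y))\<^sup>2)"
      by (simp add: sum_distrib_left mult.assoc sum_negf)
    finally have 1: "(\<Sum>x\<in>K. \<Sum>y\<in>K. a x y * (cmod (u x - u y))\<^sup>2) \<le>
      - t * (\<Sum>x\<in>K. \<Sum>y\<in>K. b x y * (cmod (u x - u y))\<^sup>2)" .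
    have "t * (\<Sum>x\<in>K. c x * (cmod (u x))\<^sup>2) = (\<Sum>y\<in>K. t * c y * (cmod (u y))\<^sup>2)"
      by (simp add: sum_distrib_left mult.assoc)
    also have "\<dots> \<le> (\<Sum>y\<in>K. (\<Sum>x\<in>K. a x y) * (cmod (u y))\<^sup>2)"
      using col by (intro sum_mono mult_right_mono) auto
    finally have 2: "t * (\<Sum>x\<in>K. c x * (cmod (u x))\<^sup>2) \<le> (\<Sum>y\<in>K. (\<Sum>x\<in>K. a x y) * (cmod (u y))\<^sup>2)" .
    have 3: "(\<Sum>x\<in>K. \<Sum>y\<in>K. a x y * Re (u x * cnj (u y))) =
        (\<Sum>y\<in>K. (\<Sum>x\<in>K. a x y) * (cmod (u y))\<^sup>2) - (1/2) * (\<Sum>x\<in>K. \<Sum>y\<in>K. a x y * (cmod (u x - u y))\<^sup>2)"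
      by (rule symmetric_quadratic_form_by_differences[OF sym])
    have 4: "t * ((1/2) * p + q) = (1/2) * (t * p) + t * q" for p q :: real by (simp add: algebra_simps)
    show ?thesis unfolding 3 4 using 1 2 by simp
  qed
  ultimately show ?thesis by simp
qed

lemma finite_energy_le_Q:
  assumes u: "u \<in> DQ" and K: "finite K"
  shows "(1/2) * (\<Sum>x\<in>K. \<Sum>y\<in>K. b x y * (cmod (u x - u y))\<^sup>2) + (\<Sum>x\<in>K. c x * (cmod (u x))\<^sup>2) \<le> Re (Q u u)"
    (is "?E \<le> _")
proof (rule ccontr)
  assume "\<not> ?E \<le> Re (Q u u)"
  then have d: "0 < ?E - Re (Q u u)" by simp
  define n where "n = (norm (to_ell2 m u))\<^sup>2"
  have n: "0 \<le> n" by (simp add: n_def)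
  \<comment> \<open>Chosen so that \<open>t\<close> times the assumed gap is \<open>n + 1\<close>,
    whereas the estimate for \<open>QT t\<close> bounds it by \<open>n\<close>.\<close>
  define t where "t = (n + 1) / (?E - Re (Q u u))"
  have t: "0 < t" unfolding t_def using d n by (intro divide_pos_pos) auto
  have "t * ?E \<le> n + t * Re (Q u u)"
    using finite_energy_le_QT[OF u K t]
    by (simp add: QT_def n_def Re_l2inner[OF mpos] DQ_l2 u power2_norm_eq_inner)
  then have "t * (?E - Re (Q u u)) \<le> n" by (simp add: right_diff_distrib)
  moreover have "t * (?E - Re (Q u u)) = n + 1" unfolding t_def using d by simp
  ultimately show False by simp
qed

lemma QN_le_form: "form_le (domN m b c) (qN b c) DQ Q"
proof -
  note b = b_facts[OF mpos graph lf]
  have main: "u \<in> domN m b c \<and> Re (qN b c u u) \<le> Re (Q u u)" if u: "u \<in> DQ" for u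
  proof -
    let ?f = "\<lambda>(x, y). b x y * (cmod (u x - u y))\<^sup>2" and ?g = "\<lambda>x. c x * (cmod (u x))\<^sup>2"
    have f0: "0 \<le> ?f p" and g0: "0 \<le> ?g x" for p x using b by (auto simp: case_prod_beta)
    \<comment> \<open>Two independent finite sets, because the edge sum and the killing sum are
      exhausted separately while their total has to stay below \<open>Re (Q u u)\<close>. The set
      \<open>?K\<close> collects all vertices that occur in either.\<close>
    have fg: "(1/2) * sum ?f F + sum ?g G \<le> Re (Q u u)" if "finite F" "finite G" for F G
    proof -
      let ?K = "fst ` F \<union> snd ` F \<union> G"
      have K: "finite ?K" using that by simp
      have "sum ?f F \<le> sum ?f (?K \<times> ?K)" using K f0 by (intro sum_mono2) (auto simp: image_iff, force+)
      also have "\<dots> = (\<Sum>x\<in>?K. \<Sum>y\<in>?K. b x y * (cmod (u x - u y))\<^sup>2)" by (simp add: sum.cartesian_product)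
      finally have 1: "sum ?f F \<le> (\<Sum>x\<in>?K. \<Sum>y\<in>?K. b x y * (cmod (u x - u y))\<^sup>2)" .
      have "sum ?g G \<le> sum ?g ?K" using K g0 by (intro sum_mono2) auto
      then show ?thesis using finite_energy_le_Q[OF u K] 1 by linarith
    qed
    have fle: "sum ?f F \<le> 2 * Re (Q u u)" if "finite F" for F using fg[OF that, of "{}"] by simp
    have gle: "sum ?g G \<le> Re (Q u u)" if "finite G" for G using fg[of "{}" G] that by simp
    have fs: "?f summable_on UNIV"
      by (rule nonneg_bdd_above_summable_on) (use f0 fle in \<open>auto intro!: bdd_aboveI2[where M = "2 * Re (Q u u)"]\<close>)
    have gs: "?g summable_on UNIV"
      by (rule nonneg_bdd_above_summable_on) (use g0 gle in \<open>auto intro!: bdd_aboveI2[where M = "Re (Q u u)"]\<close>)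
    have inf: "(1/2) * infsum ?f UNIV + infsum ?g UNIV \<le> Re (Q u u)"
    proof -
      have "infsum ?f UNIV \<le> 2 * (Re (Q u u) - sum ?g G)" if "finite G" for G
        using fg[OF _ that] by (intro infsum_le_finite_sums[OF fs]) (simp add: field_simps)
      then have "infsum ?g UNIV \<le> Re (Q u u) - (1/2) * infsum ?f UNIV"
        by (intro infsum_le_finite_sums[OF gs]) (simp add: field_simps)
      then show ?thesis by simp
    qed
    have ff: "(case p of (x, y) \<Rightarrow> complex_of_real (b x y) * (u x - u y) * cnj (u x - u y)) = complex_of_real (?f p)" for p
      unfolding case_prod_beta of_real_mult complex_norm_square by (simp add: mult.assoc)
    have gg: "complex_of_real (c x) * u x * cnj (u x) = complex_of_real (?g x)" for x
      unfolding of_real_mult complex_norm_square by (simp add: mult.assoc)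
    have "Re (\<Sum>\<^sub>\<infinity>(x, y). complex_of_real (b x y) * (u x - u y) * cnj (u x - u y)) = infsum ?f UNIV"
      unfolding ff infsum_Re[OF summable_on_of_real[OF fs], symmetric] Re_complex_of_real ..
    moreover have "Re (\<Sum>\<^sub>\<infinity>x. complex_of_real (c x) * u x * cnj (u x)) = infsum ?g UNIV"
      unfolding gg infsum_Re[OF summable_on_of_real[OF gs], symmetric] Re_complex_of_real ..
    ultimately have "Re (qN b c u u) = (1/2) * infsum ?f UNIV + infsum ?g UNIV"
      unfolding qN_def by simp
    then show ?thesis using inf fs gs DQ_l2[OF u] unfolding domN_def by simp
  qed
  then show ?thesis unfolding form_le_def by blast
qed

end

theorem mainTheorem13:
  fixes m :: "'v::countable \<Rightarrow> real" and b :: "'v \<Rightarrow> 'v \<Rightarrow> real" and c :: "'v \<Rightarrow> real"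
    and D :: "('v \<Rightarrow> complex) set" and L :: "('v \<Rightarrow> complex) \<Rightarrow> ('v \<Rightarrow> complex)"
  assumes "\<forall>x. 0 < m x"
    and "graph_over b c" and "locally_finite b"
    and "selfadjoint m D L" and "nonneg_op m D L"
    and "\<forall>u\<in>D. L u = Ltilde b c m u"
    and "dirichlet_form m (assoc_form_dom m D L) (assoc_form m D L)"
  shows "form_le (domN m b c) (qN b c) (assoc_form_dom m D L) (assoc_form m D L) \<and>
         form_le (assoc_form_dom m D L) (assoc_form m D L) (domD m b c) (qD m b c)"
  using QN_le_form[OF assms] form_le_QD[OF assms] by blast

end
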